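(* Let $A_{-1},A_0,A_1$ be the semi-infinite matrices described in the context, and assume that $A_{-1}\mathbf 1>A_1\mathbf 1$. Let $G$ be the minimal nonnegative solution of $A_1X^2+A_0X+A_{-1}=X$. Define \[ F_1(X)=A_{-1}+A_0X+A_1X^2,\quad F_2(X)=(I-A_0)^{-1}(A_{-1}+A_1X^2),\quad F_3(X)=(I-A_0-A_1X)^{-1}A_{-1}, \] and \[ H_1=A_0+A_1+A_1G,\quad H_2=(I-A_0)^{-1}(A_1+A_1G),\quad H_3=(I-A_0-A_1G)^{-1}A_1 . \] For $i\in\{1,2,3\}$ define $X_{k+1}^{(i)}=F_i(X_k^{(i)})$, $k=0,1,2,\ldots$, with $X_0^{(i)}=0$. Then for each $i\in\{1,2,3\}$: 1. the sequence $\{X_k^{(i)}\}_k$ is well defined (i.e., the inverses that occur exist in $\mathcal L_\infty$); 2. $0\le X_k^{(i)}\le X_{k+1}^{(i)}\le G$ for all $k\ge 0$; 3. the error $\mathcal E_k^{(i)}=G-X_k^{(i)}$ satisfies $\|\mathcal E_{k+1}^{(i)}\|_\infty\le\|H_i\|_\infty\,\|\mathcal E_k^{(i)}\|_\infty$ for all $k\ge0$, so that $\lim_{k\to\infty}\|\mathcal E_k^{(i)}\|_\infty=0$.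
   Context: For $i=-1,0,1$, $A_i$ is the semi-infinite tridiagonal matrix (rows and columns indexed by $1,2,\ldots$) whose first row is $[b_{i,0},b_{i,1},0,\ldots]$ and whose $r$-th row, $r\ge2$, has entries $a_{i,-1},a_{i,0},a_{i,1}$ in columns $r-1,r,r+1$ and zeros elsewhere. Here $a_{i,j}\ge0$, $b_{i,j}\ge0$, $\sum_{i,j=-1}^1a_{i,j}=1$ and $\sum_{i=-1}^1\sum_{j=0}^1b_{i,j}=1$. Hence $(A_{-1}+A_0+A_1)\mathbf 1=\mathbf 1$, where $\mathbf 1$ is the infinite vector of all ones. Inequalities between vectors and matrices are entrywise. $\mathcal L_\infty$ is the Banach algebra of semi-infinite matrices $A=(a_{i,j})$ that define bounded operators $\ell^\infty\to\ell^\infty$, with norm $\|A\|_\infty=\sup_i\sum_j|a_{i,j}|$; $I$ is the identity matrix. A solution $X\ge0$ of a matrix equation is minimal nonnegative if $Y-X\ge0$ for every other nonnegative solution $Y$. It is known that the minimal nonnegative solution $G$ of $A_1X^2+A_0X+A_{-1}=X$ exists and that $G\mathbf 1\le\mathbf 1$. *)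

theory Defs
  imports Complex_Main "HOL-Library.Function_Algebras"
begin

text \<open>
  Semi-infinite real matrices. Rows and columns are indexed from 0, so index \<open>r\<close> here is
  \<open>r + 1\<close> in the usual numbering from 1. The order, \<open>0\<close>, \<open>+\<close> and \<open>-\<close> are the pointwise ones on
  functions (thus \<open>\<le>\<close> is the entrywise inequality). Beware that \<open>*\<close> and \<open>1\<close> are also pointwise on
  functions and that \<open><\<close> is not the entrywise strict inequality; none of these is used on
  matrices or vectors.
\<close>

type_synonym smat = "nat \<Rightarrow> nat \<Rightarrow> real"
type_synonym svec = "nat \<Rightarrow> real"

definition ones :: svec where
  "ones = (\<lambda>_. 1)"

definition smat_id :: smat where
  "smat_id = (\<lambda>r c. if r = c then 1 else 0)"

definition smat_vec :: "smat \<Rightarrow> svec \<Rightarrow> svec" where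
  "smat_vec A x = (\<lambda>r. \<Sum>k. A r k * x k)"

definition smat_mult :: "smat \<Rightarrow> smat \<Rightarrow> smat"  (infixl "\<odot>" 70) where
  "A \<odot> B = (\<lambda>r c. \<Sum>k. A r k * B k c)"

text \<open>The product above is a total function; it is meaningful when all its series converge.\<close>

definition smat_mult_defined :: "smat \<Rightarrow> smat \<Rightarrow> bool" where
  "smat_mult_defined A B \<longleftrightarrow> (\<forall>r c. summable (\<lambda>k. A r k * B k c))"

text \<open>
  The matrices that define bounded operators on \<open>\<ell>\<^sup>\<infinity>\<close>, the space of bounded sequences (\<open>Bseq\<close>)
  with the supremum norm.
\<close>

definition Linf :: "smat set" where
  "Linf = {A. (\<forall>x. Bseq x \<longrightarrow> (\<forall>r. summable (\<lambda>k. A r k * x k))) \<and>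
              (\<exists>C. \<forall>x. Bseq x \<longrightarrow> (\<forall>r. \<bar>smat_vec A x r\<bar> \<le> C * (SUP k. \<bar>x k\<bar>)))}"

text \<open>Meaningful on \<open>Linf\<close> only, see \<open>Linf_iff\<close> below.\<close>

definition Linf_norm :: "smat \<Rightarrow> real" where
  "Linf_norm A = (SUP r. \<Sum>c. \<bar>A r c\<bar>)"

lemma Linf_iff:
  "A \<in> Linf \<longleftrightarrow>
     (\<forall>r. summable (\<lambda>c. \<bar>A r c\<bar>)) \<and> bdd_above (range (\<lambda>r. \<Sum>c. \<bar>A r c\<bar>))"
proof (intro iffI conjI allI)
  have sgn_eq: "A r k * sgn (A r k) = \<bar>A r k\<bar>" for r k
    by (simp add: abs_sgn)
  have sgn_B: "Bseq (\<lambda>k. sgn (A r k))" for r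
    by (rule BseqI'[of _ 1]) (simp add: sgn_if)
  assume A: "A \<in> Linf"
  show summ: "summable (\<lambda>c. \<bar>A r c\<bar>)" for r
  proof -
    have "summable (\<lambda>k. A r k * sgn (A r k))"
      using A sgn_B[of r] unfolding Linf_def by blast
    then show ?thesis by (simp only: sgn_eq)
  qed
  obtain C where C: "\<And>x r. Bseq x \<Longrightarrow> \<bar>smat_vec A x r\<bar> \<le> C * (SUP k. \<bar>x k\<bar>)"
    using A unfolding Linf_def by blast
  show "bdd_above (range (\<lambda>r. \<Sum>c. \<bar>A r c\<bar>))"
  proof (rule bdd_aboveI2)
    fix r
    have le1: "\<bar>sgn (A r k)\<bar> \<le> 1" for k by (simp add: sgn_if)
    then have bdd: "bdd_above (range (\<lambda>k. \<bar>sgn (A r k)\<bar>))" by (intro bdd_aboveI2)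
    have S1: "(SUP k. \<bar>sgn (A r k)\<bar>) \<le> 1" by (rule cSUP_least) (use le1 in auto)
    have S0: "0 \<le> (SUP k. \<bar>sgn (A r k)\<bar>)"
      using cSUP_upper[OF _ bdd, of 0] by (meson UNIV_I abs_ge_zero order_trans)
    have "(\<Sum>c. \<bar>A r c\<bar>) = smat_vec A (\<lambda>k. sgn (A r k)) r"
      by (simp add: smat_vec_def sgn_eq)
    also have "\<dots> \<le> C * (SUP k. \<bar>sgn (A r k)\<bar>)"
      using C[OF sgn_B[of r], of r] by linarith
    also have "\<dots> \<le> \<bar>C\<bar> * (SUP k. \<bar>sgn (A r k)\<bar>)" using S0 by (intro mult_right_mono) auto
    also have "\<dots> \<le> \<bar>C\<bar> * 1" using S1 by (intro mult_left_mono) auto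
    finally show "(\<Sum>c. \<bar>A r c\<bar>) \<le> \<bar>C\<bar>" by simp
  qed
next
  assume H: "(\<forall>r. summable (\<lambda>c. \<bar>A r c\<bar>)) \<and> bdd_above (range (\<lambda>r. \<Sum>c. \<bar>A r c\<bar>))"
  have le: "\<bar>x k\<bar> \<le> (SUP k. \<bar>x k\<bar>)" if B: "Bseq x" for x :: svec and k
  proof -
    from B obtain K where "\<And>k. \<bar>x k\<bar> \<le> K" by (metis BseqE real_norm_def)
    then have "bdd_above (range (\<lambda>k. \<bar>x k\<bar>))" by (intro bdd_aboveI2)
    then show ?thesis by (rule cSUP_upper[rotated]) simp
  qed
  have term_le: "\<bar>A r k * x k\<bar> \<le> \<bar>A r k\<bar> * (SUP k. \<bar>x k\<bar>)" if "Bseq x" for x r k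
    unfolding abs_mult using le[OF that] by (intro mult_left_mono) auto
  have dom: "summable (\<lambda>k. \<bar>A r k\<bar> * (SUP k. \<bar>x k\<bar>))" for x r
    using H by (intro summable_mult2) blast
  have abs_summ: "summable (\<lambda>k. \<bar>A r k * x k\<bar>)" if "Bseq x" for x r
    by (rule summable_comparison_test'[OF dom[of r x], of 0]) (use term_le[OF that] in simp)
  obtain C where C: "\<And>r. (\<Sum>c. \<bar>A r c\<bar>) \<le> C"
    using H by (auto simp: bdd_above_def)
  have "\<bar>smat_vec A x r\<bar> \<le> C * (SUP k. \<bar>x k\<bar>)" if B: "Bseq x" for x r
  proof -
    have "\<bar>smat_vec A x r\<bar> \<le> (\<Sum>k. \<bar>A r k * x k\<bar>)"
      unfolding smat_vec_def by (rule summable_rabs[OF abs_summ[OF B]])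
    also have "\<dots> \<le> (\<Sum>k. \<bar>A r k\<bar> * (SUP k. \<bar>x k\<bar>))"
      by (intro suminf_le term_le B abs_summ dom)
    also have "\<dots> = (\<Sum>k. \<bar>A r k\<bar>) * (SUP k. \<bar>x k\<bar>)"
      using H by (intro suminf_mult2[symmetric]) blast
    also have "\<dots> \<le> C * (SUP k. \<bar>x k\<bar>)"
      using C le[OF B, of 0] by (intro mult_right_mono) (auto intro: order_trans[OF abs_ge_zero])
    finally show ?thesis .
  qed
  then show "A \<in> Linf"
    unfolding Linf_def using summable_rabs_cancel[OF abs_summ] by blast
qed

definition Linf_invertible :: "smat \<Rightarrow> bool" where
  "Linf_invertible A \<longleftrightarrow>
     A \<in> Linf \<and> (\<exists>B\<in>Linf. A \<odot> B = smat_id \<and> B \<odot> A = smat_id)"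

text \<open>Meaningful when \<open>Linf_invertible A\<close> holds.\<close>

definition Linf_inv :: "smat \<Rightarrow> smat" where
  "Linf_inv A = (THE B. B \<in> Linf \<and> A \<odot> B = smat_id \<and> B \<odot> A = smat_id)"

text \<open>
  First row \<open>b 0, b 1, 0, \<dots>\<close>; every later row carries \<open>a (-1), a 0, a 1\<close> on the sub-, main and
  superdiagonal.
\<close>

definition semi_tridiag :: "(int \<Rightarrow> real) \<Rightarrow> (int \<Rightarrow> real) \<Rightarrow> smat" where
  "semi_tridiag a b = (\<lambda>r c.
     let d = int c - int r in
     if r = 0 then (if d \<in> {0, 1} then b d else 0)
     else (if d \<in> {-1, 0, 1} then a d else 0))"

definition qbd_equation :: "(int \<Rightarrow> smat) \<Rightarrow> smat \<Rightarrow> bool" where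
  "qbd_equation A X \<longleftrightarrow>
     smat_mult_defined X X \<and> A 1 \<odot> (X \<odot> X) + A 0 \<odot> X + A (-1) = X"

definition minimal_nonneg_solution :: "(smat \<Rightarrow> bool) \<Rightarrow> smat \<Rightarrow> bool" where
  "minimal_nonneg_solution E X \<longleftrightarrow>
     0 \<le> X \<and> E X \<and> (\<forall>Y. 0 \<le> Y \<and> E Y \<longrightarrow> 0 \<le> Y - X)"

definition F1 :: "(int \<Rightarrow> smat) \<Rightarrow> smat \<Rightarrow> smat" where
  "F1 A X = A (-1) + A 0 \<odot> X + A 1 \<odot> (X \<odot> X)"

definition F2 :: "(int \<Rightarrow> smat) \<Rightarrow> smat \<Rightarrow> smat" where
  "F2 A X = Linf_inv (smat_id - A 0) \<odot> (A (-1) + A 1 \<odot> (X \<odot> X))"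

definition F3 :: "(int \<Rightarrow> smat) \<Rightarrow> smat \<Rightarrow> smat" where
  "F3 A X = Linf_inv (smat_id - A 0 - A 1 \<odot> X) \<odot> A (-1)"

definition H1 :: "(int \<Rightarrow> smat) \<Rightarrow> smat \<Rightarrow> smat" where
  "H1 A G = A 0 + A 1 + A 1 \<odot> G"

definition H2 :: "(int \<Rightarrow> smat) \<Rightarrow> smat \<Rightarrow> smat" where
  "H2 A G = Linf_inv (smat_id - A 0) \<odot> (A 1 + A 1 \<odot> G)"

definition H3 :: "(int \<Rightarrow> smat) \<Rightarrow> smat \<Rightarrow> smat" where
  "H3 A G = Linf_inv (smat_id - A 0 - A 1 \<odot> G) \<odot> A 1"

text \<open>Selection by \<open>i \<in> {1, 2, 3}\<close>; other values of \<open>i\<close> are irrelevant.\<close>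

definition fp_map :: "(int \<Rightarrow> smat) \<Rightarrow> nat \<Rightarrow> smat \<Rightarrow> smat" where
  "fp_map A i = (if i = 1 then F1 A else if i = 2 then F2 A else F3 A)"

definition err_mat :: "(int \<Rightarrow> smat) \<Rightarrow> smat \<Rightarrow> nat \<Rightarrow> smat" where
  "err_mat A G i = (if i = 1 then H1 A G else if i = 2 then H2 A G else H3 A G)"

primrec fp_iter :: "(smat \<Rightarrow> smat) \<Rightarrow> nat \<Rightarrow> smat" where
  "fp_iter f 0 = 0"
| "fp_iter f (Suc k) = f (fp_iter f k)"

end

theory Submission
  imports Defs "HOL-Analysis.Infinite_Sum" "HOL-Analysis.Uniform_Limit"
begin

text \<open>
  For nonnegative matrices the norm of \<open>\<L>\<^sub>\<infinity>\<close> is the supremum of the row sums, so every estimate is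
  an estimate of row sums. The drift condition takes only two different values over the rows, hence
  holds with a uniform gap \<open>\<delta> > 0\<close>. This makes \<open>A\<^sub>0\<close> and \<open>A\<^sub>0 + A\<^sub>1 Z\<close>, for substochastic \<open>Z\<close>, have norm
  at most \<open>1 - \<delta>\<close>, so that Neumann series provide nonnegative inverses.

  The differences of the three maps are
  \<open>F\<^sub>1(W) - F\<^sub>1(Z) = A\<^sub>0 (W - Z) + A\<^sub>1 (W (W - Z) + (W - Z) Z)\<close>,
  \<open>F\<^sub>2(W) - F\<^sub>2(Z) = (I - A\<^sub>0)\<^sup>-\<^sup>1 A\<^sub>1 (W (W - Z) + (W - Z) Z)\<close> and
  \<open>F\<^sub>3(W) - F\<^sub>3(Z) = (I - A\<^sub>0 - A\<^sub>1 W)\<^sup>-\<^sup>1 A\<^sub>1 (W - Z) F\<^sub>3(Z)\<close>.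
  They give monotonicity for \<open>Z \<le> W\<close>, and for \<open>W = G\<close>, since \<open>Z\<close> and \<open>F\<^sub>3(Z)\<close> are substochastic, the row
  sums of the new error are at most those of \<open>H\<^sub>i (G - Z)\<close>. Finally \<open>\<parallel>H\<^sub>i\<parallel> \<le> 1 - \<delta>\<close>. That \<open>G\<close> is
  substochastic follows from minimality, because the limit of the iteration of \<open>F\<^sub>1\<close> from \<open>0\<close> is a
  substochastic solution.
\<close>

subsection \<open>The algebra of bounded semi-infinite matrices\<close>

text \<open>The hypotheses amount to absolute summability over the product set, a condition
  symmetric in the two indices; Fubini for \<open>infsum\<close> is then translated to
  \<open>suminf\<close>.\<close>

lemma suminf_swap:
  fixes f :: "nat \<Rightarrow> nat \<Rightarrow> real"
  assumes row: "\<And>i. summable (\<lambda>j. \<bar>f i j\<bar>)" and rows: "summable (\<lambda>i. \<Sum>j. \<bar>f i j\<bar>)"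
  shows "summable (\<lambda>i. \<bar>f i j\<bar>)"
    and "summable (\<lambda>j. \<Sum>i. \<bar>f i j\<bar>)"
    and "(\<Sum>i. \<Sum>j. f i j) = (\<Sum>j. \<Sum>i. f i j)"
proof -
  have suminf_eq: "infsum g UNIV = suminf g" if "summable (\<lambda>n. \<bar>g n\<bar>)" for g :: "nat \<Rightarrow> real"
    using norm_summable_imp_has_sum[of g] that summable_rabs_cancel[OF that]
    by (auto intro!: infsumI)
  have ab: "(\<lambda>(i, j). f i j) abs_summable_on UNIV \<times> UNIV"
    unfolding abs_summable_on_Sigma_iff using row rows
    by (auto simp: summable_on_UNIV_nonneg_real_iff suminf_eq suminf_nonneg)
  then have ab': "(\<lambda>(j, i). f i j) abs_summable_on UNIV \<times> UNIV"
    by (subst (asm) summable_on_swap) (simp add: case_prod_unfold)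
  have col: "summable (\<lambda>i. \<bar>f i j\<bar>)" for j
    using ab' unfolding abs_summable_on_Sigma_iff by (auto simp: summable_on_UNIV_nonneg_real_iff)
  have cols: "summable (\<lambda>j. \<Sum>i. \<bar>f i j\<bar>)"
    using ab' col unfolding abs_summable_on_Sigma_iff
    by (auto simp: summable_on_UNIV_nonneg_real_iff suminf_eq suminf_nonneg)
  show "summable (\<lambda>i. \<bar>f i j\<bar>)" by (rule col)
  show "summable (\<lambda>j. \<Sum>i. \<bar>f i j\<bar>)" by (rule cols)
  have le: "\<bar>\<Sum>j. f i j\<bar> \<le> (\<Sum>j. \<bar>f i j\<bar>)" "\<bar>\<Sum>i. f i j\<bar> \<le> (\<Sum>i. \<bar>f i j\<bar>)" for i j
    using row col by (auto intro: summable_rabs)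
  have "summable (\<lambda>i. \<bar>\<Sum>j. f i j\<bar>)"
    by (rule summable_comparison_test'[OF rows, of 0]) (use le in simp)
  moreover have "summable (\<lambda>j. \<bar>\<Sum>i. f i j\<bar>)"
    by (rule summable_comparison_test'[OF cols, of 0]) (use le in simp)
  ultimately show "(\<Sum>i. \<Sum>j. f i j) = (\<Sum>j. \<Sum>i. f i j)"
    using infsum_swap_banach[OF abs_summable_summable[OF ab]]
    by (simp add: suminf_eq row col)
qed

text \<open>This is the form applied to matrices, where the absolute row sums are only estimated by
  a summable majorant \<open>g\<close>.\<close>

lemma suminf_swap_bounded:
  fixes f :: "nat \<Rightarrow> nat \<Rightarrow> real"
  assumes row: "\<And>i. summable (\<lambda>j. \<bar>f i j\<bar>)"
    and le: "\<And>i. (\<Sum>j. \<bar>f i j\<bar>) \<le> g i" and g: "summable g"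
  shows "(\<Sum>i. \<Sum>j. f i j) = (\<Sum>j. \<Sum>i. f i j)" "summable (\<lambda>j. \<Sum>i. f i j)"
proof -
  have rows: "summable (\<lambda>i. \<Sum>j. \<bar>f i j\<bar>)"
    by (rule summable_comparison_test'[OF g, of 0]) (use le row in \<open>auto simp: suminf_nonneg\<close>)
  note sw = suminf_swap[OF row rows]
  show "(\<Sum>i. \<Sum>j. f i j) = (\<Sum>j. \<Sum>i. f i j)" by (fact sw)
  show "summable (\<lambda>j. \<Sum>i. f i j)"
    by (rule summable_comparison_test'[OF sw(2), of 0]) (use summable_rabs[OF sw(1)] in auto)
qed

section \<open>Entrywise order and closure properties of \<open>Linf\<close>\<close>

lemma smat_leI: "(\<And>r c. A r c \<le> B r c) \<Longrightarrow> A \<le> (B :: smat)"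
  by (simp add: le_fun_def)

lemma smat_leD: "A \<le> (B :: smat) \<Longrightarrow> A r c \<le> B r c"
  by (simp add: le_fun_def)

lemma smat_nonnegD: "0 \<le> (A :: smat) \<Longrightarrow> 0 \<le> A r c"
  by (simp add: le_fun_def)

lemma LinfI:
  assumes "\<And>r. summable (\<lambda>c. \<bar>A r c\<bar>)" "\<And>r. (\<Sum>c. \<bar>A r c\<bar>) \<le> C"
  shows "A \<in> Linf"
  unfolding Linf_iff using assms by (auto intro!: bdd_aboveI2)

lemma Linf_summable: "A \<in> Linf \<Longrightarrow> summable (\<lambda>c. \<bar>A r c\<bar>)"
  by (simp add: Linf_iff)

lemma Linf_row_le: "A \<in> Linf \<Longrightarrow> (\<Sum>c. \<bar>A r c\<bar>) \<le> Linf_norm A"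
  unfolding Linf_norm_def Linf_iff by (auto intro: cSUP_upper)

lemma Linf_entry_le: "A \<in> Linf \<Longrightarrow> \<bar>A r c\<bar> \<le> Linf_norm A"
  using sum_le_suminf[OF Linf_summable, of A "{c}" r] Linf_row_le[of A r] by simp

lemma Linf_norm_leI: "(\<And>r. (\<Sum>c. \<bar>A r c\<bar>) \<le> C) \<Longrightarrow> Linf_norm A \<le> C"
  unfolding Linf_norm_def by (rule cSUP_least) auto

lemma Linf_dominated:
  assumes "B \<in> Linf" "\<And>r c. \<bar>A r c\<bar> \<le> \<bar>B r c\<bar>"
  shows "A \<in> Linf"
proof (rule LinfI)
  show s: "summable (\<lambda>c. \<bar>A r c\<bar>)" for r
    by (rule summable_comparison_test'[OF Linf_summable[OF assms(1), of r], of 0]) (use assms in auto)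
  show "(\<Sum>c. \<bar>A r c\<bar>) \<le> Linf_norm B" for r
    using suminf_le[OF assms(2)[of r] s Linf_summable[OF assms(1)]] Linf_row_le[OF assms(1), of r]
    by linarith
qed

lemma Linf_between: "B \<in> Linf \<Longrightarrow> 0 \<le> A \<Longrightarrow> A \<le> B \<Longrightarrow> A \<in> Linf"
  by (erule Linf_dominated) (auto simp: le_fun_def intro: order_trans[OF _ abs_ge_self])

lemma Linf_add: "A \<in> Linf \<Longrightarrow> B \<in> Linf \<Longrightarrow> A + B \<in> Linf"
proof (rule LinfI)
  assume A: "A \<in> Linf" and B: "B \<in> Linf"
  note s = summable_add[OF Linf_summable[OF A] Linf_summable[OF B]]
  show s': "summable (\<lambda>c. \<bar>(A + B) r c\<bar>)" for r
    by (rule summable_comparison_test'[OF s[of r r], of 0]) auto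
  show "(\<Sum>c. \<bar>(A + B) r c\<bar>) \<le> Linf_norm A + Linf_norm B" for r
  proof -
    have "(\<Sum>c. \<bar>(A + B) r c\<bar>) \<le> (\<Sum>c. \<bar>A r c\<bar> + \<bar>B r c\<bar>)"
      by (intro suminf_le s s') auto
    also have "\<dots> = (\<Sum>c. \<bar>A r c\<bar>) + (\<Sum>c. \<bar>B r c\<bar>)"
      by (intro suminf_add[symmetric] Linf_summable A B)
    finally show ?thesis using Linf_row_le[OF A, of r] Linf_row_le[OF B, of r] by linarith
  qed
qed

lemma Linf_uminus: "A \<in> Linf \<Longrightarrow> - A \<in> Linf"
  by (erule Linf_dominated) simp

lemma Linf_diff: "A \<in> Linf \<Longrightarrow> B \<in> Linf \<Longrightarrow> A - B \<in> Linf"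
  using Linf_add[OF _ Linf_uminus, of A B] by simp

lemma smat_id_sums: "(\<lambda>c. smat_id r c * x c) sums x r"
  using sums_If_finite_set[of "{r}" x]
  by (simp add: smat_id_def if_distrib[of "\<lambda>t. t * _"] eq_commute cong: if_cong)

lemma Linf_id: "smat_id \<in> Linf"
proof (rule LinfI[of _ 1])
  have "(\<lambda>c. \<bar>smat_id r c\<bar>) sums 1" for r
    using smat_id_sums[of r "\<lambda>_. 1"] by (simp add: smat_id_def)
  then show "summable (\<lambda>c. \<bar>smat_id r c\<bar>)" "(\<Sum>c. \<bar>smat_id r c\<bar>) \<le> 1" for r
    by (auto simp: sums_iff)
qed

lemma smat_id_nonneg: "0 \<le> smat_id"
  by (simp add: le_fun_def smat_id_def)

lemma Linf_zero: "0 \<in> Linf"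
  by (rule LinfI[of _ 0]) auto

section \<open>Action on bounded vectors and the matrix product\<close>

lemma smat_vec_abs_summable:
  assumes A: "A \<in> Linf" and x: "\<And>k. \<bar>x k\<bar> \<le> K"
  shows "summable (\<lambda>k. \<bar>A r k * x k\<bar>)"
  by (rule summable_comparison_test'[OF summable_mult2[OF Linf_summable[OF A, of r], of K], of 0])
    (auto simp: abs_mult intro!: mult_left_mono x)

lemmas smat_vec_summable = smat_vec_abs_summable[THEN summable_rabs_cancel]

lemma smat_vec_bound:
  assumes A: "A \<in> Linf" and x: "\<And>k. \<bar>x k\<bar> \<le> K"
  shows "(\<Sum>k. \<bar>A r k * x k\<bar>) \<le> Linf_norm A * K" "\<bar>smat_vec A x r\<bar> \<le> Linf_norm A * K"
proof -
  have K: "0 \<le> K" using x[of 0] by simp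
  have "(\<Sum>k. \<bar>A r k * x k\<bar>) \<le> (\<Sum>k. \<bar>A r k\<bar> * K)"
    by (intro suminf_le smat_vec_abs_summable[OF A x] summable_mult2 Linf_summable A)
      (auto simp: abs_mult intro!: mult_left_mono x)
  also have "\<dots> = (\<Sum>k. \<bar>A r k\<bar>) * K"
    by (intro suminf_mult2[symmetric] Linf_summable A)
  also have "\<dots> \<le> Linf_norm A * K"
    by (intro mult_right_mono Linf_row_le A K)
  finally show *: "(\<Sum>k. \<bar>A r k * x k\<bar>) \<le> Linf_norm A * K" .
  show "\<bar>smat_vec A x r\<bar> \<le> Linf_norm A * K"
    using summable_rabs[OF smat_vec_abs_summable[OF A x]] * unfolding smat_vec_def
    by (rule order_trans)
qed

lemma smat_mult_eq_vec: "(A \<odot> B) r c = smat_vec A (\<lambda>k. B k c) r"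
  by (simp add: smat_mult_def smat_vec_def)

text \<open>The family \<open>A r k * (B k c * x c)\<close> has absolute sums over \<open>c\<close>
  of at most \<open>\<bar>A r k\<bar> * (Linf_norm B * K)\<close>, summable in \<open>k\<close>, so
  the two summations commute. Taking \<open>x\<close> as a column or as \<open>ones\<close> yields
  associativity and the row sums of a product.\<close>

lemma smat_vec_mult:
  assumes A: "A \<in> Linf" and B: "B \<in> Linf" and x: "\<And>k. \<bar>x k\<bar> \<le> K"
  shows "summable (\<lambda>c. (A \<odot> B) r c * x c)"
    and "smat_vec (A \<odot> B) x = smat_vec A (smat_vec B x)"
proof -
  define f where "f r k c = A r k * (B k c * x c)" for r k c
  have row: "summable (\<lambda>c. \<bar>f r k c\<bar>)" for r k
    unfolding f_def abs_mult[of "A r k"]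
    by (intro summable_mult smat_vec_abs_summable[OF B x])
  have rowle: "(\<Sum>c. \<bar>f r k c\<bar>) \<le> \<bar>A r k\<bar> * (Linf_norm B * K)" for r k
    unfolding f_def abs_mult[of "A r k"]
    by (subst suminf_mult)
      (auto intro!: mult_left_mono smat_vec_bound[OF B x] smat_vec_abs_summable[OF B x])
  have sw: "(\<Sum>k. \<Sum>c. f r k c) = (\<Sum>c. \<Sum>k. f r k c)" "summable (\<lambda>c. \<Sum>k. f r k c)" for r
    using suminf_swap_bounded[of "f r", OF row rowle summable_mult2[OF Linf_summable[OF A]]] by auto
  have col: "(\<Sum>k. f r k c) = (A \<odot> B) r c * x c" for r c
  proof -
    have "(\<Sum>k. f r k c) = (\<Sum>k. (A r k * B k c) * x c)"
      by (simp add: f_def mult.assoc)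
    also have "\<dots> = (A \<odot> B) r c * x c"
      unfolding smat_mult_def
      by (intro suminf_mult2[symmetric] smat_vec_summable[OF A Linf_entry_le[OF B]])
    finally show ?thesis .
  qed
  show "summable (\<lambda>c. (A \<odot> B) r c * x c)"
    using sw(2)[of r] by (simp add: col)
  show "smat_vec (A \<odot> B) x = smat_vec A (smat_vec B x)"
  proof
    fix r
    have "smat_vec A (smat_vec B x) r = (\<Sum>k. \<Sum>c. f r k c)"
      unfolding smat_vec_def f_def
      by (intro suminf_cong suminf_mult[symmetric] smat_vec_summable[OF B x])
    also have "\<dots> = (\<Sum>c. \<Sum>k. f r k c)" by (rule sw)
    also have "\<dots> = smat_vec (A \<odot> B) x r" by (simp add: col smat_vec_def)
    finally show "smat_vec (A \<odot> B) x r = smat_vec A (smat_vec B x) r" by simp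
  qed
qed

text \<open>Entrywise absolute values of the factors give a dominating product, whose row sums are
  found by applying it to the constant vector 1.\<close>

lemma Linf_mult:
  assumes A: "A \<in> Linf" and B: "B \<in> Linf"
  shows "A \<odot> B \<in> Linf"
proof -
  define A' B' where "A' = (\<lambda>r c. \<bar>A r c\<bar>)" and "B' = (\<lambda>r c. \<bar>B r c\<bar>)"
  have A': "A' \<in> Linf" and B': "B' \<in> Linf"
    by (rule Linf_dominated[OF A] Linf_dominated[OF B]; simp add: A'_def B'_def)+
  have one: "\<bar>1 :: real\<bar> \<le> 1" by simp
  have pos: "0 \<le> (A' \<odot> B') r c" for r c
    unfolding smat_mult_def
    by (intro suminf_nonneg smat_vec_summable[OF A' Linf_entry_le[OF B']]) (auto simp: A'_def B'_def)
  have "A' \<odot> B' \<in> Linf"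
  proof (rule LinfI)
    show "summable (\<lambda>c. \<bar>(A' \<odot> B') r c\<bar>)" for r
      using smat_vec_mult(1)[OF A' B', of "\<lambda>_. 1", OF one, of r] by (simp add: pos)
    show "(\<Sum>c. \<bar>(A' \<odot> B') r c\<bar>) \<le> Linf_norm A' * (Linf_norm B' * 1)" for r
    proof -
      have "(\<Sum>c. \<bar>(A' \<odot> B') r c\<bar>) = smat_vec A' (smat_vec B' (\<lambda>_. 1)) r"
        using fun_cong[OF smat_vec_mult(2)[OF A' B', of "\<lambda>_. 1", OF one], of r]
        by (simp add: smat_vec_def pos)
      then show ?thesis
        using smat_vec_bound(2)[OF A', of "smat_vec B' (\<lambda>_. 1)", OF smat_vec_bound(2)[OF B' one], of r]
        by linarith
    qed
  qed
  then show ?thesis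
  proof (rule Linf_dominated)
    fix r c
    have "\<bar>(A \<odot> B) r c\<bar> \<le> (\<Sum>k. \<bar>A r k * B k c\<bar>)"
      unfolding smat_mult_def by (intro summable_rabs smat_vec_abs_summable[OF A Linf_entry_le[OF B]])
    then show "\<bar>(A \<odot> B) r c\<bar> \<le> \<bar>(A' \<odot> B') r c\<bar>"
      using pos[of r c] by (simp add: smat_mult_def A'_def B'_def abs_mult)
  qed
qed

lemma smat_mult_assoc:
  assumes "A \<in> Linf" "B \<in> Linf" "C \<in> Linf"
  shows "(A \<odot> B) \<odot> C = A \<odot> (B \<odot> C)"
  using smat_vec_mult(2)[OF assms(1,2) Linf_entry_le[OF assms(3)]]
  by (intro ext) (simp add: smat_mult_eq_vec)

lemma smat_vec_add_left:
  assumes "A \<in> Linf" "B \<in> Linf" "\<And>k. \<bar>x k\<bar> \<le> K"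
  shows "smat_vec (A + B) x = smat_vec A x + smat_vec B x"
  using suminf_add[OF smat_vec_summable[OF assms(1,3)] smat_vec_summable[OF assms(2,3)]]
  by (intro ext) (simp add: smat_vec_def distrib_right)

lemma smat_vec_diff_left:
  assumes "A \<in> Linf" "B \<in> Linf" "\<And>k. \<bar>x k\<bar> \<le> K"
  shows "smat_vec (A - B) x = smat_vec A x - smat_vec B x"
  using suminf_diff[OF smat_vec_summable[OF assms(1,3)] smat_vec_summable[OF assms(2,3)]]
  by (intro ext) (simp add: smat_vec_def left_diff_distrib)

lemma smat_vec_add_right:
  assumes "A \<in> Linf" "\<And>k. \<bar>x k\<bar> \<le> K" "\<And>k. \<bar>y k\<bar> \<le> L"
  shows "smat_vec A (\<lambda>k. x k + y k) = smat_vec A x + smat_vec A y"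
  using suminf_add[OF smat_vec_summable[OF assms(1,2)] smat_vec_summable[OF assms(1,3)]]
  by (intro ext) (simp add: smat_vec_def distrib_left)

lemma smat_vec_diff_right:
  assumes "A \<in> Linf" "\<And>k. \<bar>x k\<bar> \<le> K" "\<And>k. \<bar>y k\<bar> \<le> L"
  shows "smat_vec A (\<lambda>k. x k - y k) = smat_vec A x - smat_vec A y"
  using suminf_diff[OF smat_vec_summable[OF assms(1,2)] smat_vec_summable[OF assms(1,3)]]
  by (intro ext) (simp add: smat_vec_def right_diff_distrib)

lemma smat_mult_distribs:
  assumes "A \<in> Linf" "B \<in> Linf" "C \<in> Linf"
  shows smat_distrib_right: "(A + B) \<odot> C = A \<odot> C + B \<odot> C"
    and smat_diff_distrib_right: "(A - B) \<odot> C = A \<odot> C - B \<odot> C"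
    and smat_distrib_left: "A \<odot> (B + C) = A \<odot> B + A \<odot> C"
    and smat_diff_distrib_left: "A \<odot> (B - C) = A \<odot> B - A \<odot> C"
  using smat_vec_add_left[OF assms(1,2) Linf_entry_le[OF assms(3)]]
    smat_vec_diff_left[OF assms(1,2) Linf_entry_le[OF assms(3)]]
    smat_vec_add_right[OF assms(1) Linf_entry_le[OF assms(2)] Linf_entry_le[OF assms(3)]]
    smat_vec_diff_right[OF assms(1) Linf_entry_le[OF assms(2)] Linf_entry_le[OF assms(3)]]
  by (intro ext; simp add: smat_mult_eq_vec)+

lemma smat_id_vec: "smat_vec smat_id x = x"
  using smat_id_sums by (auto simp: smat_vec_def sums_iff)

lemma smat_mult_id_left: "smat_id \<odot> A = A"
  by (intro ext) (simp add: smat_mult_eq_vec smat_id_vec)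

lemma smat_mult_id_right: "A \<odot> smat_id = A"
proof (intro ext)
  fix r c
  have "(\<lambda>k. A r k * smat_id k c) = (\<lambda>k. smat_id c k * A r k)"
    by (auto simp: smat_id_def)
  then show "(A \<odot> smat_id) r c = A r c"
    using smat_id_sums[of c "A r"] by (simp add: smat_mult_def sums_iff)
qed

lemma smat_vec_mono:
  assumes A: "A \<in> Linf" "0 \<le> A" and x: "\<And>k. \<bar>x k\<bar> \<le> K" and y: "\<And>k. \<bar>y k\<bar> \<le> L"
    and le: "\<And>k. x k \<le> y k"
  shows "smat_vec A x r \<le> smat_vec A y r"
  unfolding smat_vec_def
  by (intro suminf_le smat_vec_summable[OF A(1) x] smat_vec_summable[OF A(1) y] mult_left_mono
      le smat_nonnegD A)

lemma smat_vec_nonneg: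
  assumes A: "A \<in> Linf" "0 \<le> A" and x: "\<And>k. \<bar>x k\<bar> \<le> K" "\<And>k. 0 \<le> x k"
  shows "0 \<le> smat_vec A x r"
  unfolding smat_vec_def
  by (intro suminf_nonneg smat_vec_summable[OF A(1) x(1)] mult_nonneg_nonneg x smat_nonnegD A)

lemma smat_mult_nonneg:
  assumes "A \<in> Linf" "0 \<le> A" "B \<in> Linf" "0 \<le> B"
  shows "0 \<le> A \<odot> B"
  using smat_vec_nonneg[OF assms(1,2) Linf_entry_le[OF assms(3)] smat_nonnegD[OF assms(4)]]
  by (simp add: le_fun_def smat_mult_eq_vec)

subsection \<open>Row sums and Neumann series\<close>

lemma ones_le: "\<bar>ones k\<bar> \<le> 1"
  by (simp add: ones_def)

lemma LinfI_nonneg: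
  assumes "0 \<le> A" "\<And>r. summable (A r)" "\<And>r. (\<Sum>c. A r c) \<le> C"
  shows "A \<in> Linf" "smat_vec A ones r \<le> C"
  using LinfI[of A C] assms by (simp_all add: smat_nonnegD smat_vec_def ones_def)

lemma row_sum_abs: "0 \<le> A \<Longrightarrow> (\<Sum>c. \<bar>A r c\<bar>) = smat_vec A ones r"
  by (simp add: smat_vec_def ones_def smat_nonnegD)

lemma row_sum_le_norm: "A \<in> Linf \<Longrightarrow> 0 \<le> A \<Longrightarrow> smat_vec A ones r \<le> Linf_norm A"
  using Linf_row_le[of A r] by (simp add: row_sum_abs)

lemma row_sum_nonneg: "A \<in> Linf \<Longrightarrow> 0 \<le> A \<Longrightarrow> 0 \<le> smat_vec A ones r"
  by (rule smat_vec_nonneg[OF _ _ ones_le]) (simp_all add: ones_def)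

lemma row_sum_bounded: "A \<in> Linf \<Longrightarrow> \<bar>smat_vec A ones r\<bar> \<le> Linf_norm A"
  using smat_vec_bound(2)[OF _ ones_le] by simp

lemma row_sum_mono:
  assumes "A \<in> Linf" "B \<in> Linf" "A \<le> B"
  shows "smat_vec A ones r \<le> smat_vec B ones r"
  unfolding smat_vec_def ones_def
  by (intro suminf_le mult_right_mono smat_leD[OF assms(3)] smat_vec_summable[OF assms(1)]
      smat_vec_summable[OF assms(2)]) auto

lemma entry_le_row_sum: "A \<in> Linf \<Longrightarrow> 0 \<le> A \<Longrightarrow> A r c \<le> smat_vec A ones r"
  using sum_le_suminf[OF Linf_summable, of A "{c}" r] by (simp add: row_sum_abs)

lemma Linf_norm_nonneg: "0 \<le> A \<Longrightarrow> A \<in> Linf \<Longrightarrow> 0 \<le> Linf_norm A"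
  using row_sum_le_norm[of A 0] row_sum_nonneg[of A 0] by linarith

lemma Linf_norm_le_row_sum:
  "0 \<le> A \<Longrightarrow> (\<And>r. smat_vec A ones r \<le> C) \<Longrightarrow> Linf_norm A \<le> C"
  by (rule Linf_norm_leI) (simp add: row_sum_abs)

lemma row_sum_mult:
  assumes "A \<in> Linf" "B \<in> Linf"
  shows "smat_vec (A \<odot> B) ones = smat_vec A (smat_vec B ones)"
  by (rule smat_vec_mult(2)[OF assms ones_le])

lemma row_sum_add:
  "A \<in> Linf \<Longrightarrow> B \<in> Linf \<Longrightarrow> smat_vec (A + B) ones r = smat_vec A ones r + smat_vec B ones r"
  using smat_vec_add_left[OF _ _ ones_le] by simp

lemma row_sum_diff:
  "A \<in> Linf \<Longrightarrow> B \<in> Linf \<Longrightarrow> smat_vec (A - B) ones r = smat_vec A ones r - smat_vec B ones r"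
  using smat_vec_diff_left[OF _ _ ones_le] by simp

lemma row_sum_mult_mono:
  assumes "A \<in> Linf" "0 \<le> A" "B \<in> Linf" "C \<in> Linf"
    "\<And>k. smat_vec B ones k \<le> smat_vec C ones k"
  shows "smat_vec (A \<odot> B) ones r \<le> smat_vec (A \<odot> C) ones r"
  unfolding row_sum_mult[OF assms(1,3)] row_sum_mult[OF assms(1,4)]
  by (rule smat_vec_mono[OF assms(1,2)]) (use row_sum_bounded assms in blast)+

text \<open>This is \<open>row_sum_mult_mono\<close> with \<open>smat_id\<close> as the larger right
  factor. It lets a trailing factor with row sums at most 1 be dropped.\<close>

lemma row_sum_mult_le:
  assumes "A \<in> Linf" "0 \<le> A" "B \<in> Linf" "\<And>k. smat_vec B ones k \<le> 1"
  shows "smat_vec (A \<odot> B) ones r \<le> smat_vec A ones r"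
  using row_sum_mult_mono[OF assms(1-3) Linf_id] assms(4)
  by (simp add: smat_id_vec smat_mult_id_right ones_def)

text \<open>The norm of a nonnegative matrix depends only on its row sums, so \<open>M\<close> and
  \<open>H \<odot> E\<close> need not be comparable entry by entry.\<close>

lemma Linf_norm_le_mult:
  assumes H: "H \<in> Linf" "0 \<le> H" and E: "E \<in> Linf" "0 \<le> E" and M: "0 \<le> M"
    and le: "\<And>r. smat_vec M ones r \<le> smat_vec (H \<odot> E) ones r"
  shows "Linf_norm M \<le> Linf_norm H * Linf_norm E"
proof (rule Linf_norm_le_row_sum[OF M])
  fix r
  have "smat_vec M ones r \<le> smat_vec H (smat_vec E ones) r"
    using le[of r] by (simp add: row_sum_mult H E)
  also have "\<dots> \<le> Linf_norm H * Linf_norm E"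
    using smat_vec_bound(2)[OF H(1), of "smat_vec E ones", OF row_sum_bounded[OF E(1)], of r]
    by linarith
  finally show "smat_vec M ones r \<le> Linf_norm H * Linf_norm E" .
qed

section \<open>Two-sided inverses and the Neumann series\<close>

text \<open>Any other inverse \<open>C\<close> satisfies \<open>C = C (A B) = (C A) B = B\<close>,
  so the definite description picks the exhibited one.\<close>

lemma Linf_inv_eq:
  assumes "A \<in> Linf" "B \<in> Linf" "A \<odot> B = smat_id" "B \<odot> A = smat_id"
  shows "Linf_inv A = B"
  unfolding Linf_inv_def
proof (rule the_equality)
  show "C = B" if C: "C \<in> Linf \<and> A \<odot> C = smat_id \<and> C \<odot> A = smat_id" for C
    using smat_mult_assoc[of C A B] C assms by (simp add: smat_mult_id_left smat_mult_id_right)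
qed (use assms in simp)

lemma Linf_invertibleD:
  assumes "Linf_invertible A"
  shows "A \<in> Linf" "Linf_inv A \<in> Linf" "A \<odot> Linf_inv A = smat_id" "Linf_inv A \<odot> A = smat_id"
  using assms Linf_inv_eq unfolding Linf_invertible_def by auto

lemma Linf_inv_mult_cancel:
  assumes "Linf_invertible A" "B \<in> Linf"
  shows "Linf_inv A \<odot> (A \<odot> B) = B" "A \<odot> (Linf_inv A \<odot> B) = B"
  using smat_mult_assoc[of "Linf_inv A" A B] smat_mult_assoc[of A "Linf_inv A" B]
    Linf_invertibleD[OF assms(1)] assms(2) by (simp_all add: smat_mult_id_left)

text \<open>The inverse is the entrywise sum \<open>N\<close> of the powers of \<open>S\<close>. The
  \<open>n\<close>-th power has row sums at most \<open>q ^ n\<close>, so those of \<open>N\<close>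
  are bounded by the geometric series, and shifting the series gives
  \<open>S N = N S = N - I\<close>.\<close>

lemma neumann_inverse:
  assumes S: "S \<in> Linf" "0 \<le> S" and q: "\<And>r. smat_vec S ones r \<le> q" "q < 1"
  shows "Linf_invertible (smat_id - S)" and "0 \<le> Linf_inv (smat_id - S)"
proof -
  have q0: "0 \<le> q" using row_sum_nonneg[OF S, of 0] q(1)[of 0] by linarith
  define P where "P n = ((\<odot>) S ^^ n) smat_id" for n
  have P_0: "P 0 = smat_id" by (simp add: P_def)
  have P_Suc: "P (Suc n) = S \<odot> P n" for n by (simp add: P_def)
  have P: "P n \<in> Linf \<and> 0 \<le> P n" for n
  proof (induction n)
    case 0
    show ?case unfolding P_0 using Linf_id smat_id_nonneg by blast
  next
    case (Suc n)
    then show ?case unfolding P_Suc using Linf_mult[OF S(1)] smat_mult_nonneg[OF S] by blast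
  qed
  \<comment> \<open>The powers grow by multiplication on the left; commutation makes the same shift
    available for \<open>N \<odot> S\<close>.\<close>
  have P_comm: "P n \<odot> S = S \<odot> P n" for n
    by (induction n)
      (auto simp: P_Suc smat_mult_assoc S P, auto simp: P_def smat_mult_id_left smat_mult_id_right)
  have P_row: "smat_vec (P n) ones r \<le> q ^ n" for n r
  proof (induction n arbitrary: r)
    case 0
    show ?case by (simp add: P_def smat_id_vec ones_def)
  next
    case (Suc n)
    have "smat_vec (S \<odot> P n) ones r \<le> smat_vec S (\<lambda>_. q ^ n) r"
      unfolding row_sum_mult[OF S(1) conjunct1[OF P]]
      by (rule smat_vec_mono[OF S row_sum_bounded, of _ _ "q ^ n"]) (use P Suc q0 in auto)
    also have "\<dots> = smat_vec S ones r * q ^ n"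
      unfolding smat_vec_def ones_def
      by (simp add: suminf_mult2 Linf_summable[OF S(1), THEN summable_rabs_cancel])
    also have "\<dots> \<le> q * q ^ n" by (intro mult_right_mono q) (use q0 in simp)
    finally show ?case by (simp add: P_Suc)
  qed
  have P_abs: "\<bar>P n r c\<bar> \<le> q ^ n" for n r c
    using P_row[of n r] entry_le_row_sum[of "P n" r c] P[of n] smat_nonnegD[of "P n" r c] by auto
  have geo: "summable (\<lambda>n. q ^ n)" using q q0 by (intro summable_geometric) auto
  have P_sum: "summable (\<lambda>n. \<bar>P n r c\<bar>)" for r c
    by (rule summable_comparison_test'[OF geo, of 0]) (use P_abs in simp)
  define N where "N r c = (\<Sum>n. P n r c)" for r c
  have P_sums: "(\<lambda>n. P n r c) sums N r c" for r c
    unfolding N_def using P_sum by (auto intro: summable_rabs_cancel)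
  have P_shift: "(\<lambda>n. P (Suc n) r c) sums (N r c - smat_id r c)" for r c
    using sums_Suc_iff[of "\<lambda>n. P n r c" "N r c - smat_id r c"] P_sums[of r c] by (simp add: P_def)
  have N0: "0 \<le> N"
    by (intro smat_leI) (simp add: N_def suminf_nonneg summable_rabs_cancel[OF P_sum] smat_nonnegD P)
  have N_le: "N r c \<le> (\<Sum>n. q ^ n)" for r c
    unfolding N_def
    by (intro suminf_le geo summable_rabs_cancel[OF P_sum]) (use P_abs in \<open>auto intro: order_trans[OF abs_ge_self]\<close>)
  \<comment> \<open>Exchanging the sums over \<open>n\<close> and \<open>c\<close> turns a row sum
    of \<open>N\<close> into the series of the row sums of the powers.\<close>
  have N: "N \<in> Linf"
  proof -
    have sw: "(\<Sum>n. \<Sum>c. P n r c) = (\<Sum>c. \<Sum>n. P n r c)" "summable (\<lambda>c. \<Sum>n. P n r c)" for r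
      using suminf_swap_bounded[of "\<lambda>n c. P n r c", OF _ _ geo] P_row[of _ r] P
      by (auto simp: row_sum_abs Linf_summable)
    have "(\<Sum>n. \<Sum>c. P n r c) \<le> (\<Sum>n. q ^ n)" for r
    proof (rule suminf_le[OF _ _ geo])
      show *: "(\<Sum>c. P n r c) \<le> q ^ n" for n
        using P_row[of n r] by (simp add: smat_vec_def ones_def)
      show "summable (\<lambda>n. \<Sum>c. P n r c)"
        by (rule summable_comparison_test'[OF geo, of 0])
          (use * row_sum_nonneg[of "P _" r] P in \<open>auto simp: smat_vec_def ones_def\<close>)
    qed
    moreover have "N r = (\<lambda>c. \<Sum>n. P n r c)" for r by (simp add: fun_eq_iff N_def)
    ultimately show ?thesis
      using LinfI_nonneg(1)[OF N0, of "\<Sum>n. q ^ n"] sw by simp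
  qed
  have SN: "S \<odot> N = N - smat_id"
  proof (intro ext)
    fix r c
    have row: "summable (\<lambda>n. \<bar>S r k * P n k c\<bar>)" for k
      unfolding abs_mult by (intro summable_mult P_sum)
    have "(\<Sum>n. \<bar>S r k * P n k c\<bar>) = \<bar>S r k\<bar> * N k c" for k
      unfolding abs_mult N_def by (subst suminf_mult[OF P_sum]) (simp add: smat_nonnegD P)
    then have le: "(\<Sum>n. \<bar>S r k * P n k c\<bar>) \<le> \<bar>S r k\<bar> * (\<Sum>n. q ^ n)" for k
      by (simp add: mult_left_mono N_le)
    have "(S \<odot> N) r c = (\<Sum>k. \<Sum>n. S r k * P n k c)"
      unfolding smat_mult_def N_def
      by (intro suminf_cong suminf_mult[symmetric] summable_rabs_cancel[OF P_sum])
    also have "\<dots> = (\<Sum>n. \<Sum>k. S r k * P n k c)"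
      by (rule suminf_swap_bounded(1)[OF row le summable_mult2[OF Linf_summable[OF S(1)]]])
    also have "\<dots> = (\<Sum>n. P (Suc n) r c)" by (simp add: P_Suc smat_mult_def)
    also have "\<dots> = (N - smat_id) r c" using P_shift by (simp add: sums_iff)
    finally show "(S \<odot> N) r c = (N - smat_id) r c" .
  qed
  have NS: "N \<odot> S = N - smat_id"
  proof (intro ext)
    fix r c
    have row: "summable (\<lambda>n. \<bar>P n r k * S k c\<bar>)" for k
      unfolding abs_mult by (intro summable_mult2 P_sum)
    have "(\<Sum>n. \<bar>P n r k * S k c\<bar>) = N r k * \<bar>S k c\<bar>" for k
      unfolding abs_mult N_def by (subst suminf_mult2[OF P_sum, symmetric]) (simp add: smat_nonnegD P)
    \<comment> \<open>The majorant is now a row of \<open>N\<close> instead of a row of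
      \<open>S\<close>, so this direction relies on \<open>N \<in> Linf\<close>.\<close>
    then have le: "(\<Sum>n. \<bar>P n r k * S k c\<bar>) \<le> \<bar>N r k\<bar> * Linf_norm S" for k
      using smat_nonnegD[OF N0, of r k] by (simp add: mult_left_mono Linf_entry_le[OF S(1)])
    have "(N \<odot> S) r c = (\<Sum>k. \<Sum>n. P n r k * S k c)"
      unfolding smat_mult_def N_def
      by (intro suminf_cong suminf_mult2 summable_rabs_cancel[OF P_sum])
    also have "\<dots> = (\<Sum>n. \<Sum>k. P n r k * S k c)"
      by (rule suminf_swap_bounded(1)[OF row le summable_mult2[OF Linf_summable[OF N]]])
    also have "\<dots> = (\<Sum>n. (P n \<odot> S) r c)" by (simp add: smat_mult_def)
    also have "\<dots> = (\<Sum>n. P (Suc n) r c)" by (simp add: P_Suc P_comm)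
    also have "\<dots> = (N - smat_id) r c" using P_shift by (simp add: sums_iff)
    finally show "(N \<odot> S) r c = (N - smat_id) r c" .
  qed
  have L: "smat_id - S \<in> Linf" by (intro Linf_diff Linf_id S)
  have 1: "(smat_id - S) \<odot> N = smat_id" "N \<odot> (smat_id - S) = smat_id"
    by (simp_all add: smat_diff_distrib_right smat_diff_distrib_left Linf_id S N SN NS
        smat_mult_id_left smat_mult_id_right)
  show "Linf_invertible (smat_id - S)"
    unfolding Linf_invertible_def using L N 1 by blast
  show "0 \<le> Linf_inv (smat_id - S)"
    using Linf_inv_eq[OF L N 1] N0 by simp
qed

section \<open>Auxiliary estimates for inverses, limits and squares\<close>

lemma smat_mult_zero_right: "A \<odot> 0 = 0"
  by (intro ext) (simp add: smat_mult_def)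

lemma smat_vec_scale:
  assumes "A \<in> Linf" "\<And>k. \<bar>x k\<bar> \<le> K"
  shows "smat_vec A (\<lambda>k. c * x k) r = c * smat_vec A x r"
  using suminf_mult[OF smat_vec_summable[where r = r and x = x, OF assms], of c]
  by (simp add: smat_vec_def algebra_simps)

lemma row_sum_id: "smat_vec smat_id ones r = 1"
  by (simp add: smat_id_vec ones_def)

text \<open>Applying the nonnegative inverse to the hypothesis leaves \<open>c\<close> times the row
  sums of \<open>Linf_inv V \<odot> V\<close>, which are 1. The norms of \<open>H2\<close> and
  \<open>H3\<close> are thus bounded without estimating the inverse itself.\<close>

lemma row_sum_inv_mult_le:
  assumes V: "Linf_invertible V" "0 \<le> Linf_inv V" and M: "M \<in> Linf"
    and le: "\<And>k. smat_vec M ones k \<le> c * smat_vec V ones k"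
  shows "smat_vec (Linf_inv V \<odot> M) ones r \<le> c"
proof -
  note V' = Linf_invertibleD[OF V(1)]
  have "smat_vec (Linf_inv V \<odot> M) ones r \<le> smat_vec (Linf_inv V) (\<lambda>k. c * smat_vec V ones k) r"
    unfolding row_sum_mult[OF V'(2) M]
    by (rule smat_vec_mono[OF V'(2) V(2) row_sum_bounded[OF M] _ le, where L = "\<bar>c\<bar> * Linf_norm V"])
      (simp add: abs_mult mult_left_mono row_sum_bounded V')
  also have "\<dots> = c * smat_vec (Linf_inv V \<odot> V) ones r"
    unfolding row_sum_mult[OF V'(2) V'(1)]
    by (rule smat_vec_scale[OF V'(2) row_sum_bounded[OF V'(1)]])
  also have "\<dots> = c" by (simp add: V' row_sum_id)
  finally show ?thesis .
qed

text \<open>By Tannery's theorem: the series of each entry is dominated by \<open>D r k * K\<close>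
  uniformly in \<open>n\<close>.\<close>

lemma tendsto_smat_mult:
  assumes D: "D \<in> Linf"
    and P: "\<And>n r k. \<bar>P n r k\<bar> \<le> D r k" "\<And>r k. (\<lambda>n. P n r k) \<longlonglongrightarrow> P' r k"
    and Q: "\<And>n k c. \<bar>Q n k c\<bar> \<le> K" "\<And>k c. (\<lambda>n. Q n k c) \<longlonglongrightarrow> Q' k c"
  shows "(\<lambda>n. (P n \<odot> Q n) r c) \<longlonglongrightarrow> (P' \<odot> Q') r c"
proof -
  have "eventually (\<lambda>(k, n). norm (P n r k * Q n k c) \<le> D r k * K) (at_top \<times>\<^sub>F sequentially)"
    using P(1) Q(1) by (intro always_eventually) (auto simp: abs_mult intro!: mult_mono intro: order_trans[OF abs_ge_zero])
  moreover have "summable (\<lambda>k. D r k * K)"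
    using Linf_summable[OF D, THEN summable_rabs_cancel] by (rule summable_mult2)
  ultimately show ?thesis
    unfolding smat_mult_def
    using tannerys_theorem[of "\<lambda>k n. P n r k * Q n k c" "\<lambda>k. P' r k * Q' k c" sequentially]
      tendsto_mult[OF P(2) Q(2)] by auto
qed

text \<open>The mixed product \<open>W \<odot> Z\<close> is subtracted and added. Keeping
  \<open>Z\<close> as the last factor makes its row sum bound applicable later.\<close>

lemma smat_square_diff:
  assumes "W \<in> Linf" "Z \<in> Linf"
  shows "W \<odot> W - Z \<odot> Z = W \<odot> (W - Z) + (W - Z) \<odot> Z"
  using assms by (simp add: smat_mult_distribs)

section \<open>Substochastic matrices\<close>

text \<open>These are the nonnegative elements of the closed unit ball; membership in
  \<open>Linf\<close> guarantees that the row sums are convergent series.\<close>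

definition substochastic :: "smat \<Rightarrow> bool" where
  "substochastic Z \<longleftrightarrow> Z \<in> Linf \<and> 0 \<le> Z \<and> (\<forall>r. smat_vec Z ones r \<le> 1)"

lemma substochasticD:
  assumes "substochastic Z"
  shows "Z \<in> Linf" "0 \<le> Z" "smat_vec Z ones r \<le> 1"
  using assms by (auto simp: substochastic_def)

lemma substochastic_between:
  assumes "substochastic W" "0 \<le> Z" "Z \<le> W"
  shows "substochastic Z"
proof -
  have Z: "Z \<in> Linf" using Linf_between assms substochasticD by blast
  then show ?thesis
    using row_sum_mono[OF Z _ assms(3)] substochasticD[OF assms(1)] assms(2)
    unfolding substochastic_def by (blast intro: order_trans)
qed

lemma substochastic_zero: "substochastic 0"
  by (simp add: substochastic_def Linf_zero smat_vec_def)

lemma substochastic_mult: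
  assumes "substochastic W" "substochastic Z"
  shows "substochastic (W \<odot> Z)"
proof -
  note W = substochasticD[OF assms(1)] and Z = substochasticD[OF assms(2)]
  have "smat_vec (W \<odot> Z) ones r \<le> 1" for r
    using row_sum_mult_le[OF W(1,2) Z(1,3), of r] W(3)[of r] by linarith
  then show ?thesis
    unfolding substochastic_def using Linf_mult W Z smat_mult_nonneg by blast
qed

lemma substochastic_entry:
  assumes "substochastic Z"
  shows "0 \<le> Z r c" "Z r c \<le> 1"
  using substochasticD[OF assms] entry_le_row_sum[of Z r c] smat_nonnegD[of Z r c]
  by (blast, meson order_trans)

subsection \<open>Substochastic iterates under a uniform drift\<close>

text \<open>Abstract form of the problem in terms of nonnegativity, boundedness and row sums. The
  gap \<delta> is uniform, because strict inequality in each of infinitely many rows would not by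
  itself keep a supremum away from 1.\<close>

locale qbd =
  fixes A :: "int \<Rightarrow> smat" and \<delta> :: real
  assumes down: "A (-1) \<in> Linf" "0 \<le> A (-1)"
    and same: "A 0 \<in> Linf" "0 \<le> A 0"
    and up: "A 1 \<in> Linf" "0 \<le> A 1"
    and row_sums: "\<And>r. smat_vec (A (-1)) ones r + smat_vec (A 0) ones r + smat_vec (A 1) ones r = 1"
    and drift: "\<And>r. smat_vec (A 1) ones r + \<delta> \<le> smat_vec (A (-1)) ones r"
    and delta_pos: "0 < \<delta>"
begin

lemma row_sum_bounds:
  "0 \<le> smat_vec (A (-1)) ones r" "0 \<le> smat_vec (A 0) ones r" "0 \<le> smat_vec (A 1) ones r"
  using row_sum_nonneg down same up by blast+

lemma delta_le_1: "\<delta> \<le> 1"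
  using row_sum_bounds[of 0] row_sums[of 0] drift[of 0] by linarith

section \<open>Well-definedness, differences and monotonicity of the maps\<close>

lemma F1_substochastic:
  assumes "substochastic Z"
  shows "substochastic (F1 A Z)"
proof -
  note Z = substochasticD[OF assms] and ZZ = substochasticD[OF substochastic_mult[OF assms assms]]
  have "F1 A Z \<in> Linf"
    unfolding F1_def by (intro Linf_add Linf_mult down same up Z)
  moreover have "0 \<le> F1 A Z"
    unfolding F1_def by (intro add_nonneg_nonneg smat_mult_nonneg Linf_mult down same up Z)
  moreover have "smat_vec (F1 A Z) ones r \<le> 1" for r
    unfolding F1_def
    using row_sum_mult_le[OF same Z(1,3), of r] row_sum_mult_le[OF up ZZ(1,3), of r] row_sums[of r]
    by (simp add: row_sum_add Linf_add Linf_mult down same up Z ZZ)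
  ultimately show ?thesis unfolding substochastic_def by blast
qed

lemma F1_diff:
  assumes "W \<in> Linf" "Z \<in> Linf"
  shows "F1 A W - F1 A Z = A 0 \<odot> (W - Z) + A 1 \<odot> (W \<odot> (W - Z) + (W - Z) \<odot> Z)"
  unfolding F1_def smat_square_diff[OF assms, symmetric]
  by (simp add: smat_diff_distrib_left Linf_mult same up assms)

text \<open>As \<open>Z\<close> has row sums at most 1, those of \<open>A 0 + A 1 \<odot> Z\<close>
  are at most 1 minus those of \<open>A (-1)\<close>, which the drift makes at least \<delta>. The
  Neumann series applies with \<open>q = 1 - \<delta>\<close>.\<close>

lemma kernel_invertible:
  assumes "substochastic Z"
  shows "Linf_invertible (smat_id - A 0 - A 1 \<odot> Z)" "0 \<le> Linf_inv (smat_id - A 0 - A 1 \<odot> Z)"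
proof -
  note Z = substochasticD[OF assms]
  have S: "A 0 + A 1 \<odot> Z \<in> Linf" "0 \<le> A 0 + A 1 \<odot> Z"
    by (intro Linf_add Linf_mult add_nonneg_nonneg smat_mult_nonneg same up Z)+
  have "smat_vec (A 0 + A 1 \<odot> Z) ones r \<le> 1 - \<delta>" for r
    using row_sum_mult_le[OF up Z(1,3), of r] row_sums[of r] drift[of r] row_sum_bounds[of r]
    by (simp add: row_sum_add Linf_mult same up Z)
  from neumann_inverse[OF S this]
  show "Linf_invertible (smat_id - A 0 - A 1 \<odot> Z)" "0 \<le> Linf_inv (smat_id - A 0 - A 1 \<odot> Z)"
    using delta_pos by (simp_all add: diff_diff_add)
qed

lemma kernel_zero_invertible: "Linf_invertible (smat_id - A 0)" "0 \<le> Linf_inv (smat_id - A 0)"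
  using kernel_invertible[OF substochastic_zero] by (simp_all add: smat_mult_zero_right)

lemma F2_diff:
  assumes "W \<in> Linf" "Z \<in> Linf"
  shows "F2 A W - F2 A Z = Linf_inv (smat_id - A 0) \<odot> (A 1 \<odot> (W \<odot> (W - Z) + (W - Z) \<odot> Z))"
  unfolding F2_def smat_square_diff[OF assms, symmetric]
  by (simp add: smat_diff_distrib_left[symmetric] Linf_add Linf_diff Linf_mult same up down assms
      Linf_invertibleD[OF kernel_zero_invertible(1)])

text \<open>With \<open>V\<close> and \<open>U\<close> the kernels at \<open>W\<close> and
  \<open>Z\<close>, both \<open>V \<odot> F3 A W\<close> and \<open>U \<odot> F3 A Z\<close> equal
  \<open>A (-1)\<close>. Hence \<open>V\<close> times the difference is
  \<open>(U - V) \<odot> F3 A Z\<close>, where \<open>U - V = A 1 \<odot> (W - Z)\<close>.\<close>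

lemma F3_diff:
  assumes W: "substochastic W" and Z: "substochastic Z"
  shows "F3 A W - F3 A Z =
    Linf_inv (smat_id - A 0 - A 1 \<odot> W) \<odot> (A 1 \<odot> ((W - Z) \<odot> F3 A Z))"
proof -
  note W' = substochasticD(1)[OF W] and Z' = substochasticD(1)[OF Z]
  define V U where "V = smat_id - A 0 - A 1 \<odot> W" and "U = smat_id - A 0 - A 1 \<odot> Z"
  have V: "Linf_invertible V" and U: "Linf_invertible U"
    unfolding V_def U_def using kernel_invertible W Z by blast+
  note V' = Linf_invertibleD[OF V] and U' = Linf_invertibleD[OF U]
  have F: "F3 A W = Linf_inv V \<odot> A (-1)" "F3 A Z = Linf_inv U \<odot> A (-1)"
    by (simp_all add: F3_def V_def U_def)
  have FL: "F3 A W \<in> Linf" "F3 A Z \<in> Linf"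
    unfolding F using V' U' down Linf_mult by blast+
  have "V \<odot> (F3 A W - F3 A Z) = V \<odot> F3 A W - V \<odot> F3 A Z"
    by (simp add: smat_diff_distrib_left V' FL)
  also have "\<dots> = U \<odot> F3 A Z - V \<odot> F3 A Z"
    by (simp add: F Linf_inv_mult_cancel V U down)
  also have "\<dots> = (U - V) \<odot> F3 A Z"
    by (simp add: smat_diff_distrib_right V' U' FL)
  also have "U - V = A 1 \<odot> (W - Z)"
    by (simp add: U_def V_def smat_diff_distrib_left up W' Z')
  also have "(A 1 \<odot> (W - Z)) \<odot> F3 A Z = A 1 \<odot> ((W - Z) \<odot> F3 A Z)"
    by (intro smat_mult_assoc up Linf_diff W' Z' FL)
  finally have "Linf_inv V \<odot> (V \<odot> (F3 A W - F3 A Z)) = Linf_inv V \<odot> (A 1 \<odot> ((W - Z) \<odot> F3 A Z))"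
    by (simp only:)
  then show ?thesis
    by (simp add: Linf_inv_mult_cancel V FL Linf_diff V_def[symmetric])
qed

lemma fp_map_Linf:
  assumes "i \<in> {1, 2, 3 :: nat}" "substochastic Z"
  shows "fp_map A i Z \<in> Linf" "0 \<le> fp_map A i Z"
proof -
  note Z = substochasticD[OF assms(2)]
  have 1: "F1 A Z \<in> Linf" "0 \<le> F1 A Z"
    using F1_substochastic[OF assms(2)] substochasticD by blast+
  have *: "A (-1) + A 1 \<odot> (Z \<odot> Z) \<in> Linf" "0 \<le> A (-1) + A 1 \<odot> (Z \<odot> Z)"
    by (intro Linf_add add_nonneg_nonneg Linf_mult smat_mult_nonneg down up Z)+
  have 2: "F2 A Z \<in> Linf" "0 \<le> F2 A Z"
    unfolding F2_def by (intro Linf_mult smat_mult_nonneg Linf_invertibleD kernel_zero_invertible *)+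
  have 3: "F3 A Z \<in> Linf" "0 \<le> F3 A Z"
    unfolding F3_def by (intro Linf_mult smat_mult_nonneg Linf_invertibleD kernel_invertible assms(2) down)+
  from 1 2 3 show "fp_map A i Z \<in> Linf" "0 \<le> fp_map A i Z"
    by (auto simp: fp_map_def)
qed

text \<open>All factors on the right of the three difference formulas are nonnegative;
  \<open>Z\<close> is substochastic by comparison with \<open>W\<close>.\<close>

lemma fp_map_mono:
  assumes i: "i \<in> {1, 2, 3 :: nat}" and W: "substochastic W" and Z: "0 \<le> Z" "Z \<le> W"
  shows "fp_map A i Z \<le> fp_map A i W"
proof -
  note subZ = substochastic_between[OF W Z]
  note W' = substochasticD[OF W] and Z' = substochasticD[OF subZ]
  have F3Z: "F3 A Z \<in> Linf" "0 \<le> F3 A Z"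
    using fp_map_Linf[OF _ subZ, of 3] by (simp_all add: fp_map_def)
  have D: "W - Z \<in> Linf" "0 \<le> W - Z" using Linf_diff W' Z' Z by auto
  have *: "W \<odot> (W - Z) + (W - Z) \<odot> Z \<in> Linf" "0 \<le> W \<odot> (W - Z) + (W - Z) \<odot> Z"
    by (intro Linf_add add_nonneg_nonneg Linf_mult smat_mult_nonneg W' Z' D)+
  have "0 \<le> F1 A W - F1 A Z"
    unfolding F1_diff[OF W'(1) Z'(1)]
    by (intro add_nonneg_nonneg smat_mult_nonneg same up D *)
  moreover have "0 \<le> F2 A W - F2 A Z"
    unfolding F2_diff[OF W'(1) Z'(1)]
    by (intro smat_mult_nonneg Linf_mult Linf_invertibleD kernel_zero_invertible up *)
  moreover have "0 \<le> F3 A W - F3 A Z"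
    unfolding F3_diff[OF W subZ]
    by (intro smat_mult_nonneg Linf_mult Linf_invertibleD(2) kernel_invertible W up D F3Z)
  ultimately show ?thesis using i by (auto simp: fp_map_def)
qed

section \<open>A substochastic solution as a monotone limit\<close>

text \<open>Its purpose is to bound the minimal solution from above. The iterates of
  \<open>F1\<close> from 0 increase and stay substochastic, and their entrywise supremum solves the
  equation by dominated convergence.\<close>

lemma exists_substochastic_solution: "\<exists>L. substochastic L \<and> qbd_equation A L"
proof -
  define Y where "Y = fp_iter (F1 A)"
  have Y_0: "Y 0 = 0" by (simp add: Y_def)
  have Y_Suc: "Y (Suc n) = F1 A (Y n)" for n by (simp add: Y_def)
  have Y: "substochastic (Y n)" for n
  proof (induction n)
    case 0
    show ?case unfolding Y_0 by (rule substochastic_zero)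
  next
    case (Suc n)
    then show ?case unfolding Y_Suc by (rule F1_substochastic)
  qed
  have Y_le: "Y n \<le> Y (Suc n)" for n
  proof (induction n)
    case 0
    show ?case unfolding Y_0 by (rule substochasticD(2)[OF Y])
  next
    case (Suc n)
    then show ?case
      using fp_map_mono[of 1, OF _ Y _ Suc] substochasticD(2)[OF Y] by (simp add: fp_map_def Y_Suc)
  qed
  define L where "L r c = (SUP n. Y n r c)" for r c
  have inc: "incseq (\<lambda>n. Y n r c)" for r c
    by (rule incseq_SucI) (rule smat_leD[OF Y_le])
  have bdd: "bdd_above (range (\<lambda>n. Y n r c))" for r c
    by (rule bdd_aboveI2) (rule substochastic_entry(2)[OF Y])
  have lim: "(\<lambda>n. Y n r c) \<longlonglongrightarrow> L r c" for r c
    unfolding L_def by (rule LIMSEQ_incseq_SUP[OF bdd inc])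
  have Y_le_L: "Y n r c \<le> L r c" for n r c
    using incseq_le[OF inc lim] .
  have L0: "0 \<le> L"
    using order_trans[OF substochastic_entry(1)[OF Y] Y_le_L] by (intro smat_leI) simp
  \<comment> \<open>Finite partial sums pass to the limit termwise, which yields both the
    summability of the rows of \<open>L\<close> and the bound 1 on their sums.\<close>
  have part: "(\<Sum>c<m. L r c) \<le> 1" for r m
  proof (rule LIMSEQ_le_const2[OF tendsto_sum[OF lim]])
    show "\<exists>N. \<forall>n\<ge>N. (\<Sum>c<m. Y n r c) \<le> 1"
    proof (intro exI[of _ 0] allI impI)
      fix n
      have "(\<Sum>c<m. Y n r c) \<le> (\<Sum>c. \<bar>Y n r c\<bar>)"
        using sum_le_suminf[OF Linf_summable[OF substochasticD(1)[OF Y]], of "{..<m}" n r]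
          substochastic_entry(1)[OF Y] by simp
      then show "(\<Sum>c<m. Y n r c) \<le> 1"
        using substochasticD(2)[OF Y, of n] substochasticD(3)[OF Y, of n r] by (simp add: row_sum_abs)
    qed
  qed
  have summ: "summable (L r)" for r
    by (rule summableI_nonneg_bounded[OF _ part]) (rule smat_nonnegD[OF L0])
  have "(\<Sum>c. L r c) \<le> 1" for r
    by (rule suminf_le_const[OF summ part])
  then have L: "substochastic L"
    unfolding substochastic_def using LinfI_nonneg[OF L0 summ] L0 by blast
  note L' = substochasticD[OF L]
  have Yb: "\<bar>Y n r c\<bar> \<le> L r c" "\<bar>Y n r c\<bar> \<le> 1" for n r c
    using Y_le_L substochastic_entry[OF Y] by auto
  have YYb: "\<bar>(Y n \<odot> Y n) r c\<bar> \<le> 1" for n r c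
    using substochastic_entry[OF substochastic_mult[OF Y Y]] by simp
  \<comment> \<open>The rows of \<open>L\<close>, already known to be summable, dominate the left
    factors.\<close>
  have YY: "(\<lambda>n. (Y n \<odot> Y n) r c) \<longlonglongrightarrow> (L \<odot> L) r c" for r c
    by (rule tendsto_smat_mult[OF L'(1) Yb(1) lim Yb(2) lim])
  have A_abs: "\<bar>A 0 r k\<bar> \<le> A 0 r k" "\<bar>A 1 r k\<bar> \<le> A 1 r k" for r k
    using same up by (simp_all add: smat_nonnegD)
  have "(\<lambda>n. F1 A (Y n) r c) \<longlonglongrightarrow> F1 A L r c" for r c
    unfolding F1_def plus_fun_apply
    by (intro tendsto_add tendsto_const tendsto_smat_mult[OF same(1) A_abs(1) tendsto_const Yb(2) lim]
        tendsto_smat_mult[OF up(1) A_abs(2) tendsto_const YYb YY])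
  moreover have "(\<lambda>n. F1 A (Y n) r c) \<longlonglongrightarrow> L r c" for r c
    using LIMSEQ_Suc[OF lim] by (simp add: Y_Suc)
  ultimately have "F1 A L = L"
    by (intro ext) (rule LIMSEQ_unique)
  then have "qbd_equation A L"
    unfolding qbd_equation_def F1_def smat_mult_defined_def
    using smat_vec_summable[OF L'(1) Linf_entry_le[OF L'(1)]] by (simp add: algebra_simps)
  with L show ?thesis by blast
qed

section \<open>The solution as common fixed point and upper bound\<close>

text \<open>Moving terms in \<open>F1 A G = G\<close> gives
  \<open>(I - A 0) G = A (-1) + A 1 G G\<close> and \<open>(I - A 0 - A 1 G) G = A (-1)\<close>; the
  inverses are then applied from the left.\<close>

lemma fp_map_fixed:
  assumes i: "i \<in> {1, 2, 3 :: nat}" and G: "substochastic G" and fixed: "F1 A G = G"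
  shows "fp_map A i G = G"
proof -
  note G' = substochasticD[OF G]
  have eq: "A (-1) + A 0 \<odot> G + A 1 \<odot> (G \<odot> G) = G"
    using fixed by (simp only: F1_def)
  have "(smat_id - A 0) \<odot> G = G - A 0 \<odot> G"
    by (simp add: smat_diff_distrib_right Linf_id same G' smat_mult_id_left)
  also have "\<dots> = A (-1) + A 1 \<odot> (G \<odot> G)"
    using eq by (metis add.assoc add.commute add_diff_cancel_left')
  finally have "F2 A G = Linf_inv (smat_id - A 0) \<odot> ((smat_id - A 0) \<odot> G)"
    by (simp only: F2_def)
  then have 2: "F2 A G = G"
    using Linf_inv_mult_cancel(1)[OF kernel_zero_invertible(1) G'(1)] by (simp only:)
  have "(smat_id - A 0 - A 1 \<odot> G) \<odot> G = G - A 0 \<odot> G - A 1 \<odot> (G \<odot> G)"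
    by (simp add: smat_diff_distrib_right Linf_id Linf_diff Linf_mult same up G' smat_mult_id_left
        smat_mult_assoc)
  also have "\<dots> = A (-1)"
    using eq by (metis add_diff_cancel_right' diff_diff_eq2 diff_diff_add add.assoc)
  finally have "F3 A G = Linf_inv (smat_id - A 0 - A 1 \<odot> G) \<odot> ((smat_id - A 0 - A 1 \<odot> G) \<odot> G)"
    by (simp only: F3_def)
  then have 3: "F3 A G = G"
    using Linf_inv_mult_cancel(1)[OF kernel_invertible(1)[OF G] G'(1)] by (simp only:)
  from i fixed 2 3 show ?thesis by (auto simp: fp_map_def)
qed

text \<open>Both inequalities propagate by monotonicity, the upper one because \<open>G\<close> is a
  fixed point. The invariant bounds the next iterate by \<open>G\<close>, so that this iterate is
  substochastic and monotonicity applies to it.\<close>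

lemma fp_iter_bounds:
  assumes i: "i \<in> {1, 2, 3 :: nat}" and G: "substochastic G" and fixed: "F1 A G = G"
  shows "0 \<le> fp_iter (fp_map A i) k \<and> fp_iter (fp_map A i) k \<le> fp_iter (fp_map A i) (Suc k) \<and>
    fp_iter (fp_map A i) (Suc k) \<le> G"
proof (induction k)
  case 0
  have 1: "fp_iter (fp_map A i) (Suc 0) = fp_map A i 0" by (simp only: fp_iter.simps)
  have "0 \<le> fp_map A i 0"
    by (rule fp_map_Linf(2)[OF i substochastic_zero])
  moreover have "fp_map A i 0 \<le> G"
    using fp_map_mono[OF i G order_refl substochasticD(2)[OF G]]
    by (simp only: fp_map_fixed[OF i G fixed])
  ultimately show ?case unfolding 1 fp_iter.simps(1) by blast
next
  case (Suc k)
  let ?X = "fp_iter (fp_map A i)"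
  have sub: "substochastic (?X (Suc k))"
    by (rule substochastic_between[OF G]) (use Suc order_trans in blast)+
  have "?X (Suc (Suc k)) = fp_map A i (?X (Suc k))" by (rule fp_iter.simps)
  moreover have "?X (Suc k) \<le> fp_map A i (?X (Suc k))"
    using fp_map_mono[OF i sub conjunct1[OF Suc]] Suc by simp
  moreover have "fp_map A i (?X (Suc k)) \<le> G"
    using fp_map_mono[OF i G substochasticD(2)[OF sub]] Suc fp_map_fixed[OF i G fixed] by metis
  ultimately show ?case using substochasticD(2)[OF sub] by metis
qed

section \<open>Contraction of the error\<close>

text \<open>In row sums, \<open>H1\<close> is at most \<open>A 0\<close> plus twice
  \<open>A 1\<close>, that is 1 minus \<open>A (-1)\<close> plus \<open>A 1\<close>, hence at most
  \<open>1 - \<delta>\<close>. For \<open>H2\<close> and \<open>H3\<close> the factor after the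
  inverse is compared with the kernel being inverted.\<close>

lemma err_mat_facts:
  assumes i: "i \<in> {1, 2, 3 :: nat}" and G: "substochastic G"
  shows "err_mat A G i \<in> Linf" "0 \<le> err_mat A G i" "Linf_norm (err_mat A G i) \<le> 1 - \<delta>"
proof -
  note G' = substochasticD[OF G] and K = kernel_invertible[OF G]
  note G1 = row_sum_mult_le[OF up G'(1,3)]
  have UG: "A 1 \<odot> G \<in> Linf" "0 \<le> A 1 \<odot> G"
    by (intro Linf_mult smat_mult_nonneg up G')+
  have H1: "H1 A G \<in> Linf" "0 \<le> H1 A G"
    unfolding H1_def by (intro Linf_add add_nonneg_nonneg up same UG)+
  have H2: "H2 A G \<in> Linf" "0 \<le> H2 A G"
    unfolding H2_def
    by (intro Linf_mult smat_mult_nonneg Linf_add add_nonneg_nonneg up UG kernel_zero_invertible Linf_invertibleD(2))+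
  have H3: "H3 A G \<in> Linf" "0 \<le> H3 A G"
    unfolding H3_def by (intro Linf_mult smat_mult_nonneg up K Linf_invertibleD(2))+
  \<comment> \<open>An additive gap becomes a factor, as
    \<open>y - \<delta> \<le> y - \<delta> * y\<close> for \<open>y \<le> 1\<close>; here
    \<open>y\<close> will be a row sum of the kernel.\<close>
  have scaled: "x \<le> (1 - \<delta>) * y" if "x \<le> y - \<delta>" "y \<le> 1" for x y
  proof -
    have "\<delta> * y \<le> \<delta> * 1" using that(2) delta_pos by (intro mult_left_mono) auto
    then show ?thesis using that(1) unfolding left_diff_distrib by linarith
  qed
  have "smat_vec (H1 A G) ones r \<le> 1 - \<delta>" for r
    unfolding H1_def using G1[of r] row_sums[of r] drift[of r]
    by (simp add: row_sum_add Linf_add up same UG)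
  moreover have "smat_vec (H2 A G) ones r \<le> 1 - \<delta>" for r
    unfolding H2_def
  proof (rule row_sum_inv_mult_le[OF kernel_zero_invertible])
    fix k
    \<comment> \<open>In row sums, the left side is at most twice \<open>A 1\<close>, hence at most
      \<open>A (-1) + A 1\<close> minus \<delta>, and \<open>A (-1) + A 1\<close> has the row sums
      of \<open>smat_id - A 0\<close>.\<close>
    show "smat_vec (A 1 + A 1 \<odot> G) ones k \<le> (1 - \<delta>) * smat_vec (smat_id - A 0) ones k"
      using G1[of k] row_sums[of k] drift[of k] row_sum_bounds[of k]
      by (intro scaled) (simp_all add: row_sum_add row_sum_diff row_sum_id Linf_id up same UG)
  qed (intro Linf_add up UG)
  moreover have "smat_vec (H3 A G) ones r \<le> 1 - \<delta>" for r
    unfolding H3_def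
  proof (rule row_sum_inv_mult_le[OF K up(1)])
    fix k
    \<comment> \<open>The row sums of the kernel are at least those of \<open>A (-1)\<close>, so the
      drift supplies the gap.\<close>
    show "smat_vec (A 1) ones k \<le> (1 - \<delta>) * smat_vec (smat_id - A 0 - A 1 \<odot> G) ones k"
      using G1[of k] row_sums[of k] drift[of k] row_sum_bounds[of k] row_sum_nonneg[OF UG, of k]
      by (intro scaled) (simp_all add: row_sum_diff row_sum_id Linf_id Linf_diff up same UG)
  qed
  ultimately show "err_mat A G i \<in> Linf" "0 \<le> err_mat A G i" "Linf_norm (err_mat A G i) \<le> 1 - \<delta>"
    using i H1 H2 H3 by (auto simp: err_mat_def intro: Linf_norm_le_row_sum)
qed

text \<open>In the difference formulas the old error \<open>E\<close> is followed by
  \<open>Z\<close> or by \<open>F3 A Z\<close>. Both have row sums at most 1, so dropping them can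
  only enlarge the row sums and leaves those of \<open>err_mat A G i \<odot> E\<close>.\<close>

lemma error_step:
  assumes i: "i \<in> {1, 2, 3 :: nat}" and G: "substochastic G" and fixed: "F1 A G = G"
    and Z: "0 \<le> Z" "Z \<le> G"
  shows "Linf_norm (G - fp_map A i Z) \<le> Linf_norm (err_mat A G i) * Linf_norm (G - Z)"
proof (rule Linf_norm_le_mult[OF err_mat_facts(1,2)[OF i G]])
  note subZ = substochastic_between[OF G Z]
  note G' = substochasticD[OF G] and Z' = substochasticD[OF subZ]
  note FG = fp_map_fixed[OF i G fixed]
  define E where "E = G - Z"
  have E: "E \<in> Linf" "0 \<le> E" unfolding E_def using Linf_diff G' Z' Z by auto
  then show "G - Z \<in> Linf" "0 \<le> G - Z" by (simp_all only: E_def)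
  have FZ: "fp_map A i Z \<le> G"
    using fp_map_mono[OF i G Z] by (simp only: FG)
  then show "0 \<le> G - fp_map A i Z" by simp
  \<comment> \<open>The new iterate inherits its row sum bound from \<open>G\<close>; it is the
    trailing factor in the case \<open>i = 3\<close>.\<close>
  have subF: "substochastic (fp_map A i Z)"
    by (rule substochastic_between[OF G fp_map_Linf(2)[OF i subZ] FZ])
  note F' = substochasticD[OF subF]
  define M where "M = G \<odot> E + E \<odot> Z"
  have M: "M \<in> Linf" "0 \<le> M"
    unfolding M_def by (intro Linf_add add_nonneg_nonneg Linf_mult smat_mult_nonneg G' Z' E)+
  have GE: "G \<odot> E \<in> Linf" by (intro Linf_mult G' E)
  have UG: "A 1 \<odot> G \<in> Linf" by (intro Linf_mult up G')
  have M_row: "smat_vec M ones k \<le> smat_vec (G \<odot> E + E) ones k" for k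
    unfolding M_def
    using row_sum_mult_le[OF E Z'(1,3), of k]
    by (simp add: row_sum_add GE E Linf_mult Z')
  have AM_row: "smat_vec (A 1 \<odot> M) ones k \<le> smat_vec ((A 1 + A 1 \<odot> G) \<odot> E) ones k" for k
  proof -
    have "smat_vec (A 1 \<odot> M) ones k \<le> smat_vec (A 1 \<odot> (G \<odot> E + E)) ones k"
      by (intro row_sum_mult_mono up M M_row Linf_add GE E)
    also have "A 1 \<odot> (G \<odot> E + E) = (A 1 + A 1 \<odot> G) \<odot> E"
      by (simp add: smat_distrib_left smat_distrib_right up UG GE E G' smat_mult_assoc add.commute)
    finally show ?thesis .
  qed
  fix r
  show "smat_vec (G - fp_map A i Z) ones r \<le> smat_vec (err_mat A G i \<odot> (G - Z)) ones r"
  proof -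
    consider "i = 1" | "i = 2" | "i = 3" using i by blast
    then show ?thesis
    proof cases
      case 1
      then have "G - fp_map A i Z = A 0 \<odot> E + A 1 \<odot> M"
        using F1_diff[OF G'(1) Z'(1)] fixed by (simp add: fp_map_def E_def M_def)
      moreover have "H1 A G \<odot> E = A 0 \<odot> E + (A 1 + A 1 \<odot> G) \<odot> E"
        by (simp add: H1_def smat_distrib_right Linf_add up same UG E add.assoc)
      ultimately show ?thesis
        using 1 AM_row[of r]
        by (simp add: err_mat_def E_def[symmetric] row_sum_add Linf_mult Linf_add up same UG E M)
    next
      case 2
      let ?B = "Linf_inv (smat_id - A 0)"
      note B = Linf_invertibleD(2)[OF kernel_zero_invertible(1)]
      have "G - fp_map A i Z = ?B \<odot> (A 1 \<odot> M)"
        using F2_diff[OF G'(1) Z'(1)] FG 2 by (simp add: fp_map_def E_def M_def)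
      moreover have "H2 A G \<odot> E = ?B \<odot> ((A 1 + A 1 \<odot> G) \<odot> E)"
        unfolding H2_def by (intro smat_mult_assoc B Linf_add up UG E)
      moreover have "smat_vec (?B \<odot> (A 1 \<odot> M)) ones r \<le> smat_vec (?B \<odot> ((A 1 + A 1 \<odot> G) \<odot> E)) ones r"
        by (intro row_sum_mult_mono B kernel_zero_invertible AM_row Linf_mult Linf_add up UG E M)
      ultimately show ?thesis
        using 2 by (simp add: err_mat_def E_def[symmetric])
    next
      case 3
      let ?B = "Linf_inv (smat_id - A 0 - A 1 \<odot> G)"
      note B = Linf_invertibleD(2)[OF kernel_invertible(1)[OF G]]
      have "G - fp_map A i Z = ?B \<odot> (A 1 \<odot> (E \<odot> fp_map A i Z))"
        using F3_diff[OF G subZ] FG 3 by (simp add: fp_map_def E_def)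
      also have "\<dots> = (H3 A G \<odot> E) \<odot> fp_map A i Z"
        unfolding H3_def
        by (simp add: smat_mult_assoc Linf_mult B up E F')
      finally have "G - fp_map A i Z = (H3 A G \<odot> E) \<odot> fp_map A i Z" .
      moreover have "H3 A G \<in> Linf" "0 \<le> H3 A G"
        using err_mat_facts[OF i G] 3 by (simp_all add: err_mat_def)
      ultimately show ?thesis
        using 3 row_sum_mult_le[OF _ _ F'(1,3), of "H3 A G \<odot> E" r]
        by (simp add: err_mat_def E_def[symmetric] Linf_mult smat_mult_nonneg E)
    qed
  qed
qed

text \<open>Minimality places \<open>G\<close> below the substochastic solution, so all estimates
  for substochastic matrices apply to it. Iterating the error step with factor
  \<open>1 - \<delta>\<close> gives geometric convergence.\<close>

theorem fixed_point_convergence: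
  assumes G: "minimal_nonneg_solution (qbd_equation A) G"
    and i: "i \<in> {1, 2, 3 :: nat}" and X: "X = fp_iter (fp_map A i)"
  shows
    "(\<forall>k. X k \<in> Linf) \<and> G \<in> Linf \<and> err_mat A G i \<in> Linf \<and>
     (i = 2 \<longrightarrow> Linf_invertible (smat_id - A 0)) \<and>
     (i = 3 \<longrightarrow> (\<forall>k. Linf_invertible (smat_id - A 0 - A 1 \<odot> X k)) \<and>
                 Linf_invertible (smat_id - A 0 - A 1 \<odot> G)) \<and>
     (\<forall>k. 0 \<le> X k \<and> X k \<le> X (Suc k) \<and> X (Suc k) \<le> G) \<and>
     (\<forall>k. Linf_norm (G - X (Suc k)) \<le> Linf_norm (err_mat A G i) * Linf_norm (G - X k)) \<and>
     (\<lambda>k. Linf_norm (G - X k)) \<longlonglongrightarrow> 0"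
proof -
  obtain L where L: "substochastic L" "qbd_equation A L"
    using exists_substochastic_solution by blast
  have "0 \<le> G" and "qbd_equation A G" and "0 \<le> L - G"
    using G L substochasticD(2)[OF L(1)] unfolding minimal_nonneg_solution_def by blast+
  then have sG: "substochastic G"
    using substochastic_between[OF L(1)] by simp
  \<comment> \<open>\<open>qbd_equation\<close> and \<open>F1\<close> list the three summands in
    different orders.\<close>
  have fixed: "F1 A G = G"
    using \<open>qbd_equation A G\<close> unfolding qbd_equation_def F1_def
    by (metis add.commute add.left_commute)
  have mono: "0 \<le> X k \<and> X k \<le> X (Suc k) \<and> X (Suc k) \<le> G" for k
    unfolding X by (rule fp_iter_bounds[OF i sG fixed])
  have XG: "0 \<le> X k" "X k \<le> G" for k
    using mono[of k] order_trans by blast+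
  have sX: "substochastic (X k)" for k
    by (rule substochastic_between[OF sG XG])
  note H = err_mat_facts[OF i sG]
  have X_Suc: "X (Suc k) = fp_map A i (X k)" for k
    unfolding X by (rule fp_iter.simps)
  have step: "Linf_norm (G - X (Suc k)) \<le> Linf_norm (err_mat A G i) * Linf_norm (G - X k)" for k
    unfolding X_Suc by (rule error_step[OF i sG fixed XG])
  have E0: "0 \<le> Linf_norm (G - X k)" for k
    using XG[of k] Linf_diff sG sX substochasticD(1) by (intro Linf_norm_nonneg) auto
  have bound: "Linf_norm (G - X k) \<le> (1 - \<delta>) ^ k * Linf_norm (G - X 0)" for k
  proof (induction k)
    case (Suc k)
    have "Linf_norm (G - X (Suc k)) \<le> (1 - \<delta>) * Linf_norm (G - X k)"
      using step[of k] mult_right_mono[OF H(3) E0[of k]] by linarith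
    also have "\<dots> \<le> (1 - \<delta>) * ((1 - \<delta>) ^ k * Linf_norm (G - X 0))"
      by (rule mult_left_mono[OF Suc]) (use delta_le_1 in simp)
    finally show ?case by (simp only: power_Suc mult.assoc)
  qed simp
  have "(\<lambda>k. (1 - \<delta>) ^ k * Linf_norm (G - X 0)) \<longlonglongrightarrow> 0"
    using delta_pos delta_le_1
    by (intro tendsto_mult_left_zero LIMSEQ_power_zero) auto
  then have "(\<lambda>k. Linf_norm (G - X k)) \<longlonglongrightarrow> 0"
    by (rule tendsto_sandwich[OF _ _ tendsto_const, rotated 2]) (use E0 bound in auto)
  then show ?thesis
    using sX sG substochasticD(1) H(1) kernel_zero_invertible(1) kernel_invertible(1) mono step by blast
qed

end

section \<open>The tridiagonal blocks and their two kinds of rows\<close>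

lemma semi_tridiag_sums:
  "semi_tridiag a b 0 sums (b 0 + b 1)"
  "semi_tridiag a b (Suc r) sums (a (-1) + a 0 + a 1)"
proof -
  have "semi_tridiag a b 0 sums (\<Sum>c\<in>{0, 1}. semi_tridiag a b 0 c)"
    by (rule sums_finite) (auto simp: semi_tridiag_def Let_def)
  then show "semi_tridiag a b 0 sums (b 0 + b 1)"
    by (simp add: semi_tridiag_def)
  \<comment> \<open>The diagonal entry of row \<open>Suc r\<close> lies in column
    \<open>Suc r\<close>, so the band starts at column \<open>r\<close>.\<close>
  have "semi_tridiag a b (Suc r) sums (\<Sum>c\<in>{r, Suc r, Suc (Suc r)}. semi_tridiag a b (Suc r) c)"
    by (rule sums_finite) (auto simp: semi_tridiag_def Let_def)
  then show "semi_tridiag a b (Suc r) sums (a (-1) + a 0 + a 1)"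
    by (simp add: semi_tridiag_def Let_def add.assoc)
qed

lemma semi_tridiag_row_sum:
  "smat_vec (semi_tridiag a b) ones 0 = b 0 + b 1"
  "smat_vec (semi_tridiag a b) ones (Suc r) = a (-1) + a 0 + a 1"
  using semi_tridiag_sums(1)[of a b] semi_tridiag_sums(2)[of a b r]
  by (simp_all add: smat_vec_def ones_def sums_iff)

lemma semi_tridiag_nonneg:
  assumes "\<And>j. j \<in> {-1..1} \<Longrightarrow> 0 \<le> a j" "\<And>j. j \<in> {0..1} \<Longrightarrow> 0 \<le> b j"
  shows "0 \<le> semi_tridiag a b"
  using assms by (intro smat_leI) (auto simp: semi_tridiag_def Let_def)

lemma semi_tridiag_Linf:
  assumes "0 \<le> semi_tridiag a b"
  shows "semi_tridiag a b \<in> Linf"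
proof (rule LinfI_nonneg(1)[OF assms])
  show "summable (semi_tridiag a b r)" for r
    using semi_tridiag_sums[of a b] by (cases r) (auto simp: sums_iff)
  show "(\<Sum>c. semi_tridiag a b r c) \<le> max (b 0 + b 1) (a (-1) + a 0 + a 1)" for r
    using semi_tridiag_sums[of a b] by (cases r) (auto simp: sums_iff)
qed

theorem theorem4p2:
  fixes a b :: "int \<Rightarrow> int \<Rightarrow> real"
    and A :: "int \<Rightarrow> smat" and G :: smat
    and i :: nat and X :: "nat \<Rightarrow> smat"
  assumes a_nonneg: "\<And>m j. m \<in> {-1..1} \<Longrightarrow> j \<in> {-1..1} \<Longrightarrow> 0 \<le> a m j"
    and b_nonneg: "\<And>m j. m \<in> {-1..1} \<Longrightarrow> j \<in> {0..1} \<Longrightarrow> 0 \<le> b m j"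
    and a_sum: "(\<Sum>m=-1..1. \<Sum>j=-1..1. a m j) = 1"
    and b_sum: "(\<Sum>m=-1..1. \<Sum>j=0..1. b m j) = 1"
    and A_eq: "\<And>m. m \<in> {-1..1} \<Longrightarrow> A m = semi_tridiag (a m) (b m)"
    and drift: "\<And>r. smat_vec (A (-1)) ones r > smat_vec (A 1) ones r"
    and G_min: "minimal_nonneg_solution (qbd_equation A) G"
    and i_range: "i \<in> {1, 2, 3}"
    and X_eq: "X = fp_iter (fp_map A i)"
  shows
    \<comment> \<open>well-definedness of the sequence, and of the norms in the error bound\<close>
    "(\<forall>k. X k \<in> Linf) \<and> G \<in> Linf \<and> err_mat A G i \<in> Linf \<and>
     (i = 2 \<longrightarrow> Linf_invertible (smat_id - A 0)) \<and>
     (i = 3 \<longrightarrow> (\<forall>k. Linf_invertible (smat_id - A 0 - A 1 \<odot> X k)) \<and>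
                 Linf_invertible (smat_id - A 0 - A 1 \<odot> G)) \<and>
     (\<forall>k. 0 \<le> X k \<and> X k \<le> X (Suc k) \<and> X (Suc k) \<le> G) \<and>
     (\<forall>k. Linf_norm (G - X (Suc k)) \<le> Linf_norm (err_mat A G i) * Linf_norm (G - X k)) \<and>
     (\<lambda>k. Linf_norm (G - X k)) \<longlonglongrightarrow> 0"
proof -
  have A0: "0 \<le> A m" and AL: "A m \<in> Linf" if "m \<in> {-1..1}" for m
  proof -
    show "0 \<le> A m"
      unfolding A_eq[OF that] using a_nonneg b_nonneg that by (intro semi_tridiag_nonneg) auto
    then show "A m \<in> Linf"
      unfolding A_eq[OF that] by (rule semi_tridiag_Linf)
  qed
  have row: "smat_vec (A m) ones 0 = b m 0 + b m 1"
    "smat_vec (A m) ones (Suc r) = a m (-1) + a m 0 + a m 1" if "m \<in> {-1..1}" for m r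
    using that by (simp_all add: A_eq semi_tridiag_row_sum)
  have ints: "{-1..1} = {-1, 0, 1 :: int}" "{0..1} = {0, 1 :: int}" by auto
  \<comment> \<open>The gap has one value on row 0 and a common value on all later rows, so the
    minimum of these two positive numbers serves as \<delta>.\<close>
  define gap where "gap r = smat_vec (A (-1)) ones r - smat_vec (A 1) ones r" for r
  have gap_Suc: "gap (Suc r) = gap (Suc 0)" for r
    by (simp add: gap_def row)
  have gap_le: "min (gap 0) (gap (Suc 0)) \<le> gap r" for r
    using gap_Suc[of "r - 1"] by (cases r) (simp_all only: diff_Suc_1 min.cobounded1 min.cobounded2)
  interpret qbd A "min (gap 0) (gap (Suc 0))"
  proof
    \<comment> \<open>Row 0 uses the normalization of \<open>b\<close>, every later row that of
      \<open>a\<close>.\<close>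
    show "smat_vec (A (-1)) ones r + smat_vec (A 0) ones r + smat_vec (A 1) ones r = 1" for r
      using a_sum b_sum by (cases r) (simp_all add: row ints)
    show "smat_vec (A 1) ones r + min (gap 0) (gap (Suc 0)) \<le> smat_vec (A (-1)) ones r" for r
      using gap_le[of r] by (simp only: gap_def)
    show "0 < min (gap 0) (gap (Suc 0))"
      using drift by (simp add: gap_def)
  qed (use A0 AL in auto)
  show ?thesis by (rule fixed_point_convergence[OF G_min i_range X_eq])
qed

end
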